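(* Let $\tau=321$. Let $\{\hat X_n\}_{n=1}^\infty$, $Y$ and $\{\Pi^{321;\text{b-irr}}_{(I)}\}_{I\in\mathcal{I}}$ be mutually independent random variables, where the $\hat X_n$ are IID with $P(\hat X_n=k+1)=\frac{C_k}{2\cdot4^k}$, $k=0,1,2,\dots$; $P(Y=k)=(\frac12)^k$, $k\in\mathbb{N}$; and, for each finite block $I$, $\Pi^{321;\text{b-irr}}_{(I)}$ is uniformly distributed over the set $S^{\text{b-irr}}_{(I)}(321)$ of $321$-avoiding block irreducible permutations of $I$. Let $T_0^{\hat X}=0$ and $T_n^{\hat X}=\sum_{j=1}^n\hat X_j$. Then the limit of any weakly convergent subsequence of $\{\mu_n^{321}\}_{n=1}^\infty$ (as probability measures on $S(\mathbb{N},\mathbb{N}^* )$) is the distribution of an $S(\mathbb{N},\mathbb{N}^* )$-valued random variable of the form $$\Big(\ast_{n=0}^{Y-2}\,\Pi^{321;\text{b-irr}}_{([T_n^{\hat X}+1,\,T_{n+1}^{\hat X}])}\Big)*Z$$ for some random infinite sequence $Z$ with entries in $\mathbb{N}^*$ (defined on a common probability space with the other variables). If moreover the limiting distribution is supported on $S_\infty$, then $Z$, conditioned on $Y=y$ and $T_{y-1}^{\hat X}=M$, is almost surely a $321$-avoiding block irreducible permutation of the infinite set $\{M+1,M+2,\dots\}$.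
   Context: $\mathbb{N}=\{1,2,\dots\}$ and $[n]=\{1,\dots,n\}$. $C_n=\frac{1}{n+1}\binom{2n}{n}$ is the $n$th Catalan number. $S_n$ is the set of permutations of $[n]$. A (finite or infinite) sequence $\sigma$ of distinct integers contains $\tau=\tau_1\cdots\tau_m\in S_m$ if there are indices $i_1<\cdots<i_m$ such that for all $1\le j,k\le m$, $\sigma_{i_j}<\sigma_{i_k}$ if and only if $\tau_j<\tau_k$; otherwise it avoids $\tau$. $S_n(\tau)$ is the set of $\tau$-avoiding permutations in $S_n$, and $\mu_n^\tau$ is the uniform probability measure on $S_n(\tau)$. $\mathbb{N}^*=\mathbb{N}\cup\{\infty\}$ carries the metric $d_{\mathbb{N}^*}(i,j)=\sum_{k=i}^{j-1}2^{-k}$ for $1\le i<j\le\infty$. $S(\mathbb{N},\mathbb{N}^* )$ is the set of functions $\sigma=\{\sigma_i\}_{i=1}^\infty$ from $\mathbb{N}$ to $\mathbb{N}^*$ that are injective on $\sigma^{-1}(\mathbb{N})$, with the metric $D(\sigma,\rho)=\sum_{i=1}^\infty 2^{-i}d_{\mathbb{N}^*}(\sigma_i,\rho_i)$; it is a compact metric space. $S_\infty\subset S(\mathbb{N},\mathbb{N}^* )$ is the set of bijections $\mathbb{N}\to\mathbb{N}$. $S_n$ is regarded as a subset of $S(\mathbb{N},\mathbb{N}^* )$ by setting $\sigma_j=j$ for $j>n$, so $\mu_n^\tau$ is a probability measure on $S(\mathbb{N},\mathbb{N}^* )$. A block is a set of consecutive integers $I=\{j+i:0\le i<n^*\}\subset\mathbb{N}$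 with $n^*\in\mathbb{N}^*$ (so possibly infinite); $[a,b]=\{a,\dots,b\}$; $\mathcal{I}$ is the class of all finite blocks. $S_{(I)}$ denotes the set of permutations (bijections to itself) of the block $I$. A permutation $\sigma\in S_{(I)}$ is block irreducible if there is no integer $k\ge0$ with $k+1<n^*$ such that $\sigma$ maps $\{j,\dots,j+k\}$ to itself. $S_{(I)}(321)$ is the set of $321$-avoiding permutations in $S_{(I)}$ and $S^{\text{b-irr}}_{(I)}(321)$ is the set of block irreducible permutations in $S_{(I)}(321)$. A permutation of a block $I=\{j,j+1,\dots\}$ is identified with the listing $(\sigma_j\ \sigma_{j+1}\cdots)$ of its values. The symbol $*$ denotes concatenation of listings, the resulting infinite listing being read from left to right as the sequence of values $\sigma_1,\sigma_2,\dots$ of a function on $\mathbb{N}$. The concatenation $\ast_{n=0}^{Y-2}$ has $Y-1$ factors and is empty when $Y=1$. *)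

theory Defs
  imports "HOL-Probability.Probability"
begin

section \<open>Pattern avoidance and block irreducible permutations\<close>

text \<open>
  A sequence is a function together with its index set; a pattern is given by its one-line
  notation, so that the pattern 321 is the list \<open>[3, 2, 1]\<close>.
\<close>

definition contains_pattern :: "nat set \<Rightarrow> (nat \<Rightarrow> nat) \<Rightarrow> nat list \<Rightarrow> bool" where
  "contains_pattern I \<sigma> \<tau> \<longleftrightarrow>
     (\<exists>\<iota>. strict_mono_on {..<length \<tau>} \<iota> \<and> \<iota> ` {..<length \<tau>} \<subseteq> I \<and>
       (\<forall>j<length \<tau>. \<forall>k<length \<tau>. \<sigma> (\<iota> j) < \<sigma> (\<iota> k) \<longleftrightarrow> \<tau> ! j < \<tau> ! k))"

definition avoiders :: "nat set \<Rightarrow> nat list \<Rightarrow> (nat \<Rightarrow> nat) set" where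
  "avoiders I \<tau> = {\<sigma>. \<sigma> permutes I \<and> \<not> contains_pattern I \<sigma> \<tau>}"

definition block :: "nat \<Rightarrow> enat \<Rightarrow> nat set" where
  "block j n = {j + i |i. enat i < n}"

definition finite_blocks :: "nat set set" where
  "finite_blocks = {block j (enat n) |j n. 1 \<le> j \<and> 1 \<le> n}"

definition block_irreducible :: "nat set \<Rightarrow> (nat \<Rightarrow> nat) \<Rightarrow> bool" where
  "block_irreducible I \<sigma> \<longleftrightarrow>
     (\<forall>j n k. I = block j n \<longrightarrow> enat (k + 1) < n \<longrightarrow> \<sigma> ` {j..j + k} \<noteq> {j..j + k})"

definition birr_avoiders :: "nat set \<Rightarrow> nat list \<Rightarrow> (nat \<Rightarrow> nat) set" where
  "birr_avoiders I \<tau> = {\<sigma> \<in> avoiders I \<tau>. block_irreducible I \<sigma>}"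

definition catalan :: "nat \<Rightarrow> real" where
  "catalan n = real (2 * n choose n) / real (n + 1)"


section \<open>The space of sequences\<close>

text \<open>
  The positive integers with a point at infinity are \<open>{1..} :: enat set\<close>. Functions on the
  positive integers are represented by extensional functions on \<open>{1..} :: nat set\<close>.
\<close>

definition ext_dist :: "enat \<Rightarrow> enat \<Rightarrow> real" where
  "ext_dist i j = (\<Sum>\<^sub>\<infinity>k\<in>{k. min i j \<le> enat k \<and> enat k < max i j}. (1/2) ^ k)"

definition seqs :: "(nat \<Rightarrow> enat) set" where
  "seqs = {\<sigma> \<in> {1..} \<rightarrow>\<^sub>E {1..}. inj_on \<sigma> {i \<in> {1..}. \<sigma> i \<noteq> \<infinity>}}"

definition seq_dist :: "(nat \<Rightarrow> enat) \<Rightarrow> (nat \<Rightarrow> enat) \<Rightarrow> real" where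
  "seq_dist \<sigma> \<rho> = (\<Sum>i. (1/2) ^ Suc i * ext_dist (\<sigma> (Suc i)) (\<rho> (Suc i)))"

definition S_infinity :: "(nat \<Rightarrow> enat) set" where
  "S_infinity = {\<sigma> \<in> seqs. bij_betw \<sigma> {1..} (enat ` {1..})}"

lemma summable_on_half: "(\<lambda>k. (1/2 :: real) ^ k) summable_on A"
proof -
  have "(\<lambda>k. (1/2 :: real) ^ k) summable_on UNIV"
    by (rule norm_summable_imp_summable_on) (simp add: power_divide[symmetric])
  then show ?thesis
    by (rule summable_on_subset_banach) simp
qed

lemma ext_dist_eq_abs:
  defines "w \<equiv> \<lambda>i :: enat. \<Sum>\<^sub>\<infinity>k\<in>{k. enat k < i}. (1/2 :: real) ^ k"
  shows "ext_dist i j = \<bar>w i - w j\<bar>" and "0 \<le> w i" and "w i \<le> 2"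
    and "w i = w j \<Longrightarrow> i = j"
proof -
  have diff: "w b - w a = (\<Sum>\<^sub>\<infinity>k\<in>{k. a \<le> enat k \<and> enat k < b}. (1/2) ^ k)"
    if "a \<le> b" for a b
  proof -
    have "{k. enat k < b} - {k. enat k < a} = {k. a \<le> enat k \<and> enat k < b}"
      by (auto simp: not_less)
    moreover have "{k. enat k < a} \<subseteq> {k. enat k < b}"
      using that by auto
    ultimately show ?thesis
      using infsum_Diff[OF summable_on_half summable_on_half, of "{k. enat k < a}" "{k. enat k < b}"]
      by (simp add: w_def)
  qed
  have nonneg: "0 \<le> (\<Sum>\<^sub>\<infinity>k\<in>A. (1/2 :: real) ^ k)" for A
    by (rule infsum_nonneg) simp
  have strict: "w a < w b" if "a < b" for a b
  proof -
    obtain n where n: "a = enat n"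
      using \<open>a < b\<close> by (cases a) auto
    have "(\<Sum>\<^sub>\<infinity>k\<in>{n}. (1/2 :: real) ^ k) \<le> (\<Sum>\<^sub>\<infinity>k\<in>{k. a \<le> enat k \<and> enat k < b}. (1/2) ^ k)"
      using that n by (intro infsum_mono2 summable_on_half) auto
    moreover have "(0 :: real) < (1/2) ^ n"
      by simp
    ultimately show ?thesis
      using diff[OF less_imp_le[OF that]] by (smt (verit) infsum_finite finite.emptyI finite_insert sum.insert sum.empty empty_iff)
  qed
  show "ext_dist i j = \<bar>w i - w j\<bar>"
  proof (cases "i \<le> j")
    case True
    then show ?thesis
      using diff[of i j] nonneg[of "{k. i \<le> enat k \<and> enat k < j}"] by (simp add: ext_dist_def)
  next
    case False
    then show ?thesis
      using diff[of j i] nonneg[of "{k. j \<le> enat k \<and> enat k < i}"]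
      by (simp add: ext_dist_def min_def max_def)
  qed
  show "0 \<le> w i"
    unfolding w_def by (rule nonneg)
  have "(\<Sum>\<^sub>\<infinity>k. (1/2 :: real) ^ k) = 2"
    using infsumI[OF norm_summable_imp_has_sum[OF _ geometric_sums[of "1/2 :: real"]]]
    by (simp add: power_divide[symmetric])
  moreover have "w i \<le> (\<Sum>\<^sub>\<infinity>k. (1/2 :: real) ^ k)"
    unfolding w_def by (intro infsum_mono2 summable_on_half) auto
  ultimately show "w i \<le> 2"
    by simp
  show "i = j" if "w i = w j"
    using strict[of i j] strict[of j i] that by (metis less_irrefl linorder_cases)
qed

interpretation seqs: Metric_space seqs seq_dist
proof
  have d: "0 \<le> ext_dist i j" "ext_dist i j \<le> 2" "ext_dist i j = ext_dist j i"
    "ext_dist i j = 0 \<longleftrightarrow> i = j" "ext_dist i k \<le> ext_dist i j + ext_dist j k" for i j k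
  proof -
    define w where "w = (\<lambda>i :: enat. \<Sum>\<^sub>\<infinity>k\<in>{k. enat k < i}. (1/2 :: real) ^ k)"
    have e: "ext_dist i j = \<bar>w i - w j\<bar>" "0 \<le> w i" "w i \<le> 2" "w i = w j \<Longrightarrow> i = j" for i j
      unfolding w_def by (fact ext_dist_eq_abs)+
    show "0 \<le> ext_dist i j" "ext_dist i j = ext_dist j i"
      "ext_dist i k \<le> ext_dist i j + ext_dist j k"
      unfolding e(1) by linarith+
    show "ext_dist i j \<le> 2"
      using e(2,3)[of i] e(2,3)[of j] unfolding e(1) by linarith
    show "ext_dist i j = 0 \<longleftrightarrow> i = j"
      using e(4)[of i j] unfolding e(1) by auto
  qed
  have geo: "summable (\<lambda>i. (1/2 :: real) ^ Suc i)"
    by (simp add: summable_geometric)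
  have sm: "summable (\<lambda>i. (1/2) ^ Suc i * ext_dist (\<sigma> (Suc i)) (\<rho> (Suc i)))" for \<sigma> \<rho>
  proof (rule summable_comparison_test'[OF summable_mult[OF geo, of 2]])
    show "norm ((1/2) ^ Suc i * ext_dist (\<sigma> (Suc i)) (\<rho> (Suc i))) \<le> 2 * (1/2) ^ Suc i" for i
      using d(1,2)[of "\<sigma> (Suc i)" "\<rho> (Suc i)"]
      by (simp add: abs_mult mult.commute mult_left_mono)
  qed
  show "0 \<le> seq_dist \<sigma> \<rho>" for \<sigma> \<rho>
    unfolding seq_dist_def by (intro suminf_nonneg sm) (simp add: d(1))
  show "seq_dist \<sigma> \<rho> = seq_dist \<rho> \<sigma>" for \<sigma> \<rho>
    unfolding seq_dist_def by (subst d(3)) simp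
  show "seq_dist \<sigma> \<rho> = 0 \<longleftrightarrow> \<sigma> = \<rho>" if "\<sigma> \<in> seqs" "\<rho> \<in> seqs" for \<sigma> \<rho>
  proof
    assume "seq_dist \<sigma> \<rho> = 0"
    then have "\<sigma> (Suc i) = \<rho> (Suc i)" for i
      unfolding seq_dist_def by (subst (asm) suminf_eq_zero_iff[OF sm]) (simp_all add: d(1,4))
    then have "\<sigma> i = \<rho> i" if "i \<in> {1..}" for i
      using that by (cases i) auto
    moreover have "\<sigma> \<in> {1..} \<rightarrow>\<^sub>E {1..}" "\<rho> \<in> {1..} \<rightarrow>\<^sub>E {1..}"
      using that by (auto simp: seqs_def)
    ultimately show "\<sigma> = \<rho>"
      by (metis PiE_ext)
  qed (simp add: seq_dist_def d(4)[THEN iffD2])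
  show "seq_dist \<sigma> \<upsilon> \<le> seq_dist \<sigma> \<rho> + seq_dist \<rho> \<upsilon>" for \<sigma> \<rho> \<upsilon>
    unfolding seq_dist_def suminf_add[OF sm sm]
  proof (intro suminf_le allI sm summable_add)
    show "(1/2) ^ Suc i * ext_dist (\<sigma> (Suc i)) (\<upsilon> (Suc i)) \<le>
        (1/2) ^ Suc i * ext_dist (\<sigma> (Suc i)) (\<rho> (Suc i)) +
        (1/2) ^ Suc i * ext_dist (\<rho> (Suc i)) (\<upsilon> (Suc i))" for i
      using mult_left_mono[OF d(5), of "(1/2) ^ Suc i"] by (simp add: distrib_left)
  qed
qed


section \<open>Weak convergence\<close>

definition borel_on :: "'a topology \<Rightarrow> 'a measure" where
  "borel_on T = sigma (topspace T) {U. openin T U}"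

definition weakly_converges :: "'a topology \<Rightarrow> (nat \<Rightarrow> 'a measure) \<Rightarrow> 'a measure \<Rightarrow> bool" where
  "weakly_converges T \<nu> \<mu> \<longleftrightarrow>
     (\<forall>f. continuous_map T euclideanreal f \<and> bounded (f ` topspace T) \<longrightarrow>
       (\<lambda>n. \<integral>\<sigma>. f \<sigma> \<partial>\<nu> n) \<longlonglongrightarrow> (\<integral>\<sigma>. f \<sigma> \<partial>\<mu>))"

abbreviation seqs_borel :: "(nat \<Rightarrow> enat) measure" where
  "seqs_borel \<equiv> borel_on seqs.mtopology"

text \<open>
  A function that \<open>permutes {1..n}\<close> is the identity outside \<open>{1..n}\<close>, which is the embedding
  of the finite permutations into the space of sequences.
\<close>

definition perm_seq :: "(nat \<Rightarrow> nat) \<Rightarrow> nat \<Rightarrow> enat" where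
  "perm_seq \<sigma> = (\<lambda>i\<in>{1..}. enat (\<sigma> i))"

definition avoider_measure :: "nat list \<Rightarrow> nat \<Rightarrow> (nat \<Rightarrow> enat) measure" where
  "avoider_measure \<tau> n = distr (uniform_count_measure (avoiders {1..n} \<tau>)) seqs_borel perm_seq"


section \<open>Random listings\<close>

definition partial_sum :: "(nat \<Rightarrow> 'a \<Rightarrow> nat) \<Rightarrow> nat \<Rightarrow> 'a \<Rightarrow> nat" where
  "partial_sum X n \<omega> = (\<Sum>j=1..n. X j \<omega>)"

definition block_listing ::
    "(nat \<Rightarrow> 'a \<Rightarrow> nat) \<Rightarrow> ('a \<Rightarrow> nat) \<Rightarrow> (nat set \<Rightarrow> 'a \<Rightarrow> nat \<Rightarrow> nat) \<Rightarrow> 'a \<Rightarrow> nat list" where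
  "block_listing X Y \<Phi> \<omega> =
     concat (map (\<lambda>n. let a = partial_sum X n \<omega> + 1; b = partial_sum X (n + 1) \<omega>
                      in map (\<Phi> {a..b} \<omega>) [a..<b + 1])
       [0..<Y \<omega> - 1])"

definition perm_listing :: "nat \<Rightarrow> (nat \<Rightarrow> nat) \<Rightarrow> enat stream" where
  "perm_listing j \<sigma> = smap (\<lambda>i. enat (\<sigma> i)) (fromN j)"

text \<open>Streams are indexed from 0, the functions in \<^const>\<open>seqs\<close> from 1.\<close>

definition seq_of_stream :: "enat stream \<Rightarrow> nat \<Rightarrow> enat" where
  "seq_of_stream s = (\<lambda>i\<in>{1..}. s !! (i - 1))"

text \<open>
  Mutual independence of a family whose members take values in different types is independence
  of the generated \<open>\<sigma>\<close>-algebras.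
\<close>

datatype family_index = X_index nat | Y_index | Perm_index "nat set"

definition mutually_independent ::
    "'a measure \<Rightarrow> (nat \<Rightarrow> 'a \<Rightarrow> nat) \<Rightarrow> ('a \<Rightarrow> nat) \<Rightarrow> (nat set \<Rightarrow> 'a \<Rightarrow> nat \<Rightarrow> nat) \<Rightarrow> bool" where
  "mutually_independent M X Y \<Phi> \<longleftrightarrow>
     prob_space.indep_sets M
       (\<lambda>i. case i of
          X_index n \<Rightarrow> {X n -` A \<inter> space M |A. A \<in> sets (count_space UNIV)}
        | Y_index \<Rightarrow> {Y -` A \<inter> space M |A. A \<in> sets (count_space UNIV)}
        | Perm_index I \<Rightarrow>
            {\<Phi> I -` A \<inter> space M |A. A \<in> sets (count_space (birr_avoiders I [3, 2, 1]))})
       (X_index ` {1..} \<union> {Y_index} \<union> Perm_index ` finite_blocks)"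

text \<open>
  \<open>N\<close> is an extension of the probability space \<open>M\<close>: random variables \<open>X\<close> on \<open>M\<close> live on \<open>N\<close> as
  \<open>\<lambda>\<omega>. X (p \<omega>)\<close>, with the same joint distribution.
\<close>

definition extends_prob_space :: "'b measure \<Rightarrow> ('b \<Rightarrow> 'a) \<Rightarrow> 'a measure \<Rightarrow> bool" where
  "extends_prob_space N p M \<longleftrightarrow> prob_space N \<and> p \<in> measurable N M \<and> distr N M p = M"

end

(*
A permutation in S_n(321) that starts with a given 321-avoiding permutation of [m] is completed by
an arbitrary 321-avoiding permutation of n - m letters, so such a prefix has probability
C_(n-m) / C_n, which tends to 4^(-m). Prefix cylinders are clopen, hence 4^(-m) is also their
probability under the limit law. There are C_(k-1) irreducible blocks of size k, and
sum_k C_(k-1) 4^(-k) = 1/2; therefore, after a prefix of length m, another complete block follows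
with probability 1/2, and the limit law splits off exactly the blocks b_1, ..., b_j, of total
length m, with probability 4^(-m) / 2. By independence this is also the probability that the random
listing consists of b_1, ..., b_j. Conditioning the product of the two laws on the countable event
that both decompositions agree gives a coupling, and Z is what follows the last finite block. On
S_infinity maximality of the last split point makes Z irreducible.
*)
theory Submission
  imports Defs "HOL-Real_Asymp.Real_Asymp"
begin

section \<open>321-avoiding lists and their irreducible blocks\<close>

text \<open>A limit law may charge sequences that take the value \<infinity> or miss some integers,
  and having no later split is not decided by finitely many coordinates. Weak convergence is
  therefore applied only to events that prescribe finitely many finite values; everything else is
  derived inside \<mu>. There the last-split events are only bounded from below, because the events
  of a next block are bounded from above by subadditivity. This leaves no room for any excess, and
  none for sequences with infinitely many splits. Two Catalan counts enter: that of all avoiders,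
  from the generating tree that inserts maxima, and that of irreducible ones, from comparing the
  first-block recursion with the Catalan convolution. The given probability space need not carry the
  extra randomness of Z, so it is enlarged. The completed listing must lie in the sequence space at
  every sample point, null sets included; hence the default values.\<close>

fun av321 :: "nat list \<Rightarrow> bool" where
  "av321 [] \<longleftrightarrow> True"
| "av321 (x # xs) \<longleftrightarrow> sorted (filter (\<lambda>y. y < x) xs) \<and> av321 xs"

lemma sorted_filter_iff:
  "sorted (filter P xs) \<longleftrightarrow>
     (\<forall>j k. j < k \<longrightarrow> k < length xs \<longrightarrow> P (xs ! j) \<longrightarrow> P (xs ! k) \<longrightarrow> xs ! j \<le> xs ! k)"
proof (induction xs)
  case (Cons x xs)
  have "(\<forall>y\<in>set (filter P xs). x \<le> y) \<longleftrightarrow> (\<forall>k<length xs. P (xs ! k) \<longrightarrow> x \<le> xs ! k)"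
    by (auto simp: in_set_conv_nth)
  then show ?case
    using Cons.IH by (auto simp: All_less_Suc2 nth_Cons less_Suc_eq_0_disj split: nat.splits)
qed simp

text \<open>The recursion tries each entry as the letter 3: sortedness of the later smaller entries
  says that no descent 21 follows below it.\<close>

lemma av321_iff_nth:
  "av321 xs \<longleftrightarrow>
     (\<forall>i j k. i < j \<longrightarrow> j < k \<longrightarrow> k < length xs \<longrightarrow> \<not> (xs ! k < xs ! j \<and> xs ! j < xs ! i))"
proof (induction xs)
  case (Cons x xs)
  show ?case (is "_ \<longleftrightarrow> ?R")
  proof
    assume *: "av321 (x # xs)"
    show ?R
    proof (intro allI impI)
      fix i j k assume "i < j" "j < k" "k < length (x # xs)"
      then obtain j' k' where jk: "j = Suc j'" "k = Suc k'" by (metis Nat.lessE less_trans)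
      show "\<not> ((x # xs) ! k < (x # xs) ! j \<and> (x # xs) ! j < (x # xs) ! i)"
      proof (cases i)
        case 0
        have "sorted (filter (\<lambda>y. y < x) xs)" using * by simp
        from this[unfolded sorted_filter_iff, rule_format, of j' k'] show ?thesis
          using \<open>j < k\<close> \<open>k < _\<close> jk 0 by (auto)
      next
        case (Suc i')
        then show ?thesis using * Cons.IH \<open>i < j\<close> \<open>j < k\<close> \<open>k < _\<close> jk by auto
      qed
    qed
  next
    assume R: ?R
    have "av321 xs"
      unfolding Cons.IH using R[rule_format, of "Suc _" "Suc _" "Suc _"] by auto
    moreover have "sorted (filter (\<lambda>y. y < x) xs)"
      unfolding sorted_filter_iff
    proof (intro allI impI)
      fix j k assume "j < k" "k < length xs" "xs ! j < x" "xs ! k < x"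
      then show "xs ! j \<le> xs ! k" using R[rule_format, of 0 "Suc j" "Suc k"] by simp
    qed
    ultimately show "av321 (x # xs)" by simp
  qed
qed simp

lemma av321_sorted: "sorted xs \<Longrightarrow> av321 xs"
  by (induction xs) (auto simp: sorted_wrt_filter)

text \<open>A maximum can only play the letter 3, so a new occurrence consists of \<open>N\<close>
  followed by a descent in \<open>zs\<close>. The filters of earlier entries discard
  \<open>N\<close>.\<close>

lemma av321_insert_max:
  assumes "\<forall>x\<in>set (ys @ zs). x < N"
  shows "av321 (ys @ N # zs) \<longleftrightarrow> av321 (ys @ zs) \<and> sorted zs"
  using assms
proof (induction ys)
  case Nil
  then have "filter (\<lambda>y. y < N) zs = zs" by (simp add: filter_id_conv)
  then show ?case using av321_sorted by auto
next
  case (Cons x ys)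
  then have "filter (\<lambda>y. y < x) (ys @ N # zs) = filter (\<lambda>y. y < x) (ys @ zs)" by auto
  then show ?case using Cons by simp
qed

text \<open>Occurrences of 321 are decreasing, whereas every step from \<open>ys\<close> into
  \<open>zs\<close> goes up, so no occurrence straddles the junction.\<close>

lemma av321_append:
  assumes "\<forall>x\<in>set ys. \<forall>z\<in>set zs. x < z"
  shows "av321 (ys @ zs) \<longleftrightarrow> av321 ys \<and> av321 zs"
  using assms
proof (induction ys)
  case (Cons x ys)
  then have "filter (\<lambda>y. y < x) (ys @ zs) = filter (\<lambda>y. y < x) ys"
    by (auto simp: filter_empty_conv)
  then show ?case using Cons by simp
qed simp

lemma av321_map_add: "av321 (map (\<lambda>x. x + m) xs) \<longleftrightarrow> av321 xs"
proof (induction xs)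
  case (Cons x xs)
  have "filter (\<lambda>y. y < x + m) (map (\<lambda>x. x + m) xs) = map (\<lambda>x. x + m) (filter (\<lambda>y. y < x) xs)"
    by (simp add: filter_map o_def)
  then show ?case using Cons by (simp add: sorted_map)
qed simp

section \<open>Complete prefixes and the first irreducible block\<close>

definition avoiding_lists :: "nat \<Rightarrow> nat \<Rightarrow> nat list set" where
  "avoiding_lists a n = {xs. distinct xs \<and> set xs = {a<..a + n} \<and> av321 xs}"

text \<open>Only proper nonempty prefixes are tested, so a list is not cut by its own end. The empty
  list qualifies vacuously; positive lengths are therefore demanded wherever blocks are
  compared.\<close>

definition split_free :: "nat \<Rightarrow> nat list \<Rightarrow> bool" where
  "split_free a xs \<longleftrightarrow> (\<forall>k. 0 < k \<longrightarrow> k < length xs \<longrightarrow> set (take k xs) \<noteq> {a<..a + k})"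

definition irred_lists :: "nat \<Rightarrow> nat \<Rightarrow> nat list set" where
  "irred_lists a n = {xs \<in> avoiding_lists a n. split_free a xs}"

lemma avoiding_lists_length: "xs \<in> avoiding_lists a n \<Longrightarrow> length xs = n"
  unfolding avoiding_lists_def using distinct_card by fastforce

lemma irred_lists_length: "xs \<in> irred_lists a n \<Longrightarrow> length xs = n"
  unfolding irred_lists_def using avoiding_lists_length by auto

lemma finite_avoiding_lists [simp]: "finite (avoiding_lists a n)"
proof (rule finite_subset)
  show "avoiding_lists a n \<subseteq> {xs. set xs \<subseteq> {a<..a + n} \<and> length xs = n}"
    using avoiding_lists_length by (auto simp: avoiding_lists_def)
qed (simp add: finite_lists_length_eq)

lemma finite_irred_lists [simp]: "finite (irred_lists a n)"
  by (rule finite_subset[of _ "avoiding_lists a n"]) (auto simp: irred_lists_def)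

lemma avoiding_lists_0 [simp]: "avoiding_lists a 0 = {[]}"
  by (auto simp: avoiding_lists_def)

lemma set_map_add_eq: "set (map (\<lambda>x. x + a) xs) = {a + b<..a + b + n} \<longleftrightarrow> set xs = {b<..b + (n::nat)}"
proof -
  have "{a + b<..a + b + n} = (\<lambda>x. x + a) ` {b<..b + n}"
  proof (intro equalityI subsetI)
    fix x assume "x \<in> {a + b<..a + b + n}"
    then show "x \<in> (\<lambda>x. x + a) ` {b<..b + n}" by (intro image_eqI[of _ _ "x - a"]) auto
  qed auto
  then show ?thesis by (simp add: inj_image_eq_iff)
qed

lemma avoiding_lists_shift:
  "avoiding_lists a n = map (\<lambda>x. x + a) ` avoiding_lists 0 n" (is "?l = ?r")
  and irred_lists_shift:
  "irred_lists a n = map (\<lambda>x. x + a) ` irred_lists 0 n" (is "?l' = ?r'")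
proof -
  have shift_back: "map (\<lambda>x. x + a) (map (\<lambda>x. x - a) xs) = xs" if "set xs = {a<..a + n}" for xs :: "nat list"
    using that by (auto intro!: map_idI)
  have 1: "map (\<lambda>x. x + a) xs \<in> avoiding_lists a n \<longleftrightarrow> xs \<in> avoiding_lists 0 n" for xs
    using set_map_add_eq[of a xs 0 n]
    by (simp add: avoiding_lists_def av321_map_add distinct_map)
  have 2: "split_free a (map (\<lambda>x. x + a) xs) \<longleftrightarrow> split_free 0 xs" for xs
    using set_map_add_eq[of a _ 0]
    by (simp add: split_free_def take_map del: set_map)
  show "?l = ?r"
  proof
    show "?l \<subseteq> ?r"
    proof
      fix xs assume "xs \<in> ?l"
      then have eq: "map (\<lambda>x. x + a) (map (\<lambda>x. x - a) xs) = xs"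
        by (intro shift_back) (simp add: avoiding_lists_def)
      with \<open>xs \<in> ?l\<close> 1[of "map (\<lambda>x. x - a) xs"] have "map (\<lambda>x. x - a) xs \<in> avoiding_lists 0 n"
        by simp
      with eq show "xs \<in> ?r" by (metis image_eqI)
    qed
  qed (use 1 in auto)
  show "?l' = ?r'"
    unfolding irred_lists_def \<open>?l = ?r\<close> using 2 by auto
qed

lemma inj_map_add: "inj_on (map (\<lambda>x. x + (a::nat))) A"
  by (rule inj_on_subset[OF inj_mapI]) (auto simp: inj_def)

lemma card_avoiding_lists_shift: "card (avoiding_lists a n) = card (avoiding_lists 0 n)"
  unfolding avoiding_lists_shift[of a] by (rule card_image[OF inj_map_add])

lemma card_irred_lists_shift: "card (irred_lists a n) = card (irred_lists 0 n)"
  unfolding irred_lists_shift[of a] by (rule card_image[OF inj_map_add])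

text \<open>A complete prefix uses up an initial interval of the values, so the remainder is a list
  of the same kind at the shifted offset \<open>a + m\<close>.\<close>

lemma append_in_avoiding_lists:
  assumes "w \<in> avoiding_lists a m"
  shows "w @ v \<in> avoiding_lists a (m + n) \<longleftrightarrow> v \<in> avoiding_lists (a + m) n"
proof -
  have w: "distinct w" "set w = {a<..a + m}" "av321 w" using assms by (auto simp: avoiding_lists_def)
  have 1: "{a<..a + (m + n)} = {a<..a + m} \<union> {a + m<..a + m + n}"
    "{a<..a + m} \<inter> {a + m<..a + m + n} = {}" by auto
  show ?thesis
  proof
    assume *: "w @ v \<in> avoiding_lists a (m + n)"
    then have "set w \<union> set v = {a<..a + m} \<union> {a + m<..a + m + n}" "set w \<inter> set v = {}"
      unfolding avoiding_lists_def 1(1) by auto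
    then have "set v = {a + m<..a + m + n}" using w(2) 1(2) by blast
    then show "v \<in> avoiding_lists (a + m) n" using * w av321_append[of w v]
      by (auto simp: avoiding_lists_def)
  next
    assume *: "v \<in> avoiding_lists (a + m) n"
    then show "w @ v \<in> avoiding_lists a (m + n)"
      using 1 w av321_append[of w v] by (auto simp: avoiding_lists_def)
  qed
qed

lemma take_in_avoiding_lists:
  assumes "xs \<in> avoiding_lists a n" "k \<le> n" "set (take k xs) = {a<..a + k}"
  shows "take k xs \<in> avoiding_lists a k" "drop k xs \<in> avoiding_lists (a + k) (n - k)"
proof -
  have "av321 (take k xs)"
    using assms(1) unfolding av321_iff_nth avoiding_lists_def by auto
  then show *: "take k xs \<in> avoiding_lists a k" using assms by (auto simp: avoiding_lists_def)
  show "drop k xs \<in> avoiding_lists (a + k) (n - k)"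
    using append_in_avoiding_lists[OF *, of "drop k xs" "n - k"] assms by auto
qed

text \<open>The shortest nonempty complete prefix is irreducible, since any cut inside it would be a
  shorter one.\<close>

lemma first_irred_block:
  assumes "set (take k xs) = {a<..a + k}" "0 < k" "k \<le> length xs"
  obtains l where "0 < l" "l \<le> k" "set (take l xs) = {a<..a + l}" "split_free a (take l xs)"
proof -
  define l where "l = (LEAST l. 0 < l \<and> set (take l xs) = {a<..a + l})"
  have l: "0 < l \<and> set (take l xs) = {a<..a + l}"
    unfolding l_def by (rule LeastI[of _ k]) (use assms in auto)
  moreover have lk: "l \<le> k" unfolding l_def by (rule Least_le) (use assms in auto)
  moreover have "split_free a (take l xs)"
    unfolding split_free_def
  proof (intro allI impI)
    fix j assume "0 < j" "j < length (take l xs)"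
    then have "j < l" by simp
    with \<open>0 < j\<close> show "set (take j (take l xs)) \<noteq> {a<..a + j}"
      using not_less_Least[of j "\<lambda>l. 0 < l \<and> set (take l xs) = {a<..a + l}"]
      by (simp add: l_def[symmetric] min_absorb1)
  qed
  ultimately show ?thesis using that by blast
qed

text \<open>If the lengths differed, the shorter block would be a proper cut of the longer
  one.\<close>

lemma irred_prefix_unique:
  assumes "b @ v = b' @ v'" "b \<in> irred_lists a k" "b' \<in> irred_lists a k'" "0 < k" "0 < k'"
  shows "b = b'"
proof -
  have False if "b @ v = b' @ v'" "b \<in> irred_lists a k" "b' \<in> irred_lists a k'" "0 < k" "k < k'" for b b' v v' k k'
  proof -
    have l: "length b = k" "length b' = k'" using that irred_lists_length by auto
    then have "take k b' = b" using that by (metis append_eq_append_conv_if append_eq_conv_conj less_imp_le)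
    moreover have "set b = {a<..a + k}" using that by (auto simp: irred_lists_def avoiding_lists_def)
    ultimately show False using that l by (auto simp: irred_lists_def split_free_def)
  qed
  from this[OF assms(1,2,3,4)] this[OF assms(1)[symmetric] assms(3,2) assms(5)]
  have "k = k'" by (metis linorder_neqE_nat)
  then show ?thesis using assms irred_lists_length by (metis append_eq_append_conv)
qed

lemma avoiding_lists_decomp:
  assumes "0 < n"
  shows "avoiding_lists 0 n =
    (\<Union>k\<in>{1..n}. \<Union>b\<in>irred_lists 0 k. (\<lambda>v. b @ v) ` avoiding_lists k (n - k))" (is "?l = ?r")
proof
  show "?l \<subseteq> ?r"
  proof
    fix xs assume xs: "xs \<in> ?l"
    have "length xs = n" using xs avoiding_lists_length by auto
    obtain l where l: "0 < l" "l \<le> n" "set (take l xs) = {0<..0 + l}" "split_free 0 (take l xs)"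
      by (rule first_irred_block[of n xs 0]) (use assms xs \<open>length xs = n\<close> in \<open>auto simp: avoiding_lists_def\<close>)
    have "take l xs \<in> irred_lists 0 l" "drop l xs \<in> avoiding_lists l (n - l)"
      using take_in_avoiding_lists[OF xs l(2,3)] l by (auto simp: irred_lists_def)
    moreover have "xs = take l xs @ drop l xs" by simp
    ultimately show "xs \<in> ?r"
      using l(1,2) by (intro UN_I[of l] UN_I[of "take l xs"] image_eqI[of _ _ "drop l xs"]) auto
  qed
  show "?r \<subseteq> ?l"
  proof (safe, goal_cases)
    case (1 x k b v)
    then show ?case
      using append_in_avoiding_lists[of b 0 k v "n - k"] by (simp add: irred_lists_def)
  qed
qed

text \<open>A renewal equation: the sum runs over the length of the first irreducible block, whose
  uniqueness makes the union disjoint.\<close>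

lemma card_avoiding_lists_decomp:
  assumes "0 < n"
  shows "card (avoiding_lists 0 n) = (\<Sum>k=1..n. card (irred_lists 0 k) * card (avoiding_lists 0 (n - k)))"
proof -
  have "card (avoiding_lists 0 n) =
    (\<Sum>k\<in>{1..n}. card (\<Union>b\<in>irred_lists 0 k. (\<lambda>v. b @ v) ` avoiding_lists k (n - k)))"
    unfolding avoiding_lists_decomp[OF assms]
  proof (rule card_UN_disjoint; safe?)
    fix k j b c v u
    assume "k \<in> {1..n}" "j \<in> {1..n}" "k \<noteq> j" "b \<in> irred_lists 0 k" "c \<in> irred_lists 0 j" "b @ v = c @ u"
    with irred_prefix_unique[of b v c u 0 k j] irred_lists_length[of b 0 k] irred_lists_length[of c 0 j]
    show "b @ v \<in> {}" by auto
  qed auto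
  also have "\<dots> = (\<Sum>k=1..n. card (irred_lists 0 k) * card (avoiding_lists 0 (n - k)))"
  proof (rule sum.cong[OF refl])
    fix k assume k: "k \<in> {1..n}"
    have "card (\<Union>b\<in>irred_lists 0 k. (\<lambda>v. b @ v) ` avoiding_lists k (n - k)) =
      (\<Sum>b\<in>irred_lists 0 k. card ((\<lambda>v. b @ v) ` avoiding_lists k (n - k)))"
      by (rule card_UN_disjoint) (use irred_lists_length in auto)
    also have "\<dots> = (\<Sum>b\<in>irred_lists 0 k. card (avoiding_lists 0 (n - k)))"
      by (rule sum.cong[OF refl], subst card_image) (auto simp: inj_on_def intro: card_avoiding_lists_shift)
    finally show "card (\<Union>b\<in>irred_lists 0 k. (\<lambda>v. b @ v) ` avoiding_lists k (n - k)) =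
      card (irred_lists 0 k) * card (avoiding_lists 0 (n - k))" by simp
  qed
  finally show ?thesis .
qed

section \<open>Catalan counts\<close>

text \<open>
  This linear recursion has a unique solution, which identifies three things: a closed form, the
  coefficients of the powers of the Catalan generating function, and the size of the generating
  tree of 321-avoiding lists.
\<close>

fun ballot :: "nat \<Rightarrow> nat \<Rightarrow> nat" where
  "ballot k 0 = 1"
| "ballot 0 (Suc g) = 0"
| "ballot (Suc k) (Suc g) = ballot k (Suc g) + ballot (Suc (Suc k)) g"

text \<open>The reflection formula for ballot numbers, a difference of two binomial coefficients, in
  additive form so that no truncated difference of the two arises.\<close>

lemma ballot_closed: "ballot k g + (if g = 0 then 0 else (2 * g + k - 1) choose (g - 1)) = (2 * g + k - 1) choose g"
proof (induction k g rule: ballot.induct)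
  case (2 g)
  have "(2 * g + 1) choose g = (2 * g + 1) choose (g + 1)"
    using binomial_symmetric[of g "2 * g + 1"] by simp
  then show ?case by simp
next
  case (3 k g)
  show ?case
  proof (cases g)
    case 0
    then show ?thesis using 3 by simp
  next
    case (Suc h)
    then show ?thesis using 3 by simp
  qed
qed simp

text \<open>At \<open>k = 1\<close> the closed form is the difference of
  \<open>2 * n choose n\<close> and \<open>2 * n choose (n - 1)\<close>; absorption turns the latter
  into n / (n + 1) times the former.\<close>

lemma ballot_1: "real (ballot 1 n) = catalan n"
proof (cases n)
  case (Suc m)
  have "ballot 1 n + (2 * n choose m) = (2 * n choose n)"
    using ballot_closed[of 1 n] Suc by simp
  moreover have "Suc m * (2 * n choose Suc m) = (2 * n - m) * (2 * n choose m)"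
    by (simp only: binomial_absorb_comp binomial_absorption)
  then have "n * (2 * n choose n) = (n + 1) * (2 * n choose m)"
    by (simp add: Suc)
  ultimately have "(n + 1) * ballot 1 n + n * (2 * n choose n) = (n + 1) * (2 * n choose n)"
    by (metis add_mult_distrib2)
  then have "(n + 1) * ballot 1 n = (2 * n choose n)" by simp
  then have "real (n + 1) * real (ballot 1 n) = real (2 * n choose n)"
    by (metis of_nat_mult)
  then show ?thesis by (simp add: catalan_def field_simps)
qed (simp add: catalan_def)

fun cat_conv :: "nat \<Rightarrow> nat" where
  "cat_conv 0 = 1"
| "cat_conv (Suc n) = (\<Sum>i\<le>n. cat_conv i * cat_conv (n - i))"

text \<open>The convolution recursion says c = 1 + X c^2 for the generating function c. Multiplying
  by c^k gives c^(k+1) = c^k + X c^(k+2), whose coefficients obey the recursion of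
  \<open>ballot\<close>.\<close>

lemma ballot_eq_coeff: "fps_nth (Abs_fps (\<lambda>n. int (cat_conv n)) ^ k) g = int (ballot k g)"
proof -
  define c where "c = Abs_fps (\<lambda>n. int (cat_conv n))"
  have c: "c = 1 + fps_X * c ^ 2"
  proof (rule fps_ext)
    fix n show "fps_nth c n = fps_nth (1 + fps_X * c ^ 2) n"
    proof (cases n)
      case (Suc m)
      have "fps_nth (c ^ 2) m = (\<Sum>i\<le>m. int (cat_conv i) * int (cat_conv (m - i)))"
        unfolding power2_eq_square fps_mult_nth by (simp add: c_def atMost_atLeast0)
      then show ?thesis using Suc by (simp add: c_def)
    qed (simp add: c_def)
  qed
  have c': "c ^ Suc k = c ^ k + fps_X * c ^ Suc (Suc k)" for k
  proof -
    have "c ^ Suc k = c ^ k * (1 + fps_X * c ^ 2)" using c by (metis power_Suc2)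
    then show ?thesis by (simp add: algebra_simps power2_eq_square)
  qed
  have "fps_nth (c ^ k) g = int (ballot k g)"
  proof (induction k g rule: ballot.induct)
    case (1 k)
    then show ?case by (simp add: fps_nth_power_0) (simp add: c_def)
  next
    case (3 k g)
    then show ?case unfolding c'[of k] by simp
  qed simp
  then show ?thesis by (simp add: c_def)
qed

lemma ballot_1_conv: "ballot 1 (Suc n) = (\<Sum>i\<le>n. ballot 1 i * ballot 1 (n - i))"
proof -
  have "ballot 1 n = cat_conv n" for n
    using ballot_eq_coeff[of 1 n] by simp
  then show ?thesis by (simp only: cat_conv.simps)
qed

text \<open>The form of the recursion that matches the tree: a node with k + 1 sites has children
  with 2, ..., k + 2 sites.\<close>

lemma ballot_sum: "ballot (Suc k) (Suc g) = (\<Sum>j\<le>k. ballot (Suc (Suc j)) g)"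
  by (induction k) auto

section \<open>The generating tree of 321-avoiding lists\<close>

text \<open>
  A new maximum can be inserted exactly at these positions without creating the pattern. The number
  of sites determines the numbers of sites of all children in the generating tree.
\<close>

definition sites :: "nat list \<Rightarrow> nat set" where
  "sites xs = {t. t \<le> length xs \<and> sorted (drop t xs)}"

lemma finite_sites [simp]: "finite (sites xs)"
  by (rule finite_subset[of _ "{..length xs}"]) (auto simp: sites_def)

text \<open>Suffixes of a sorted list are sorted, so the sites are upward closed, and the end of the
  list is always a site.\<close>

lemma sites_interval: "\<exists>t\<le>length xs. sites xs = {t..length xs}"
proof -
  define t where "t = (LEAST t. sorted (drop t xs))"
  have t: "sorted (drop t xs)" unfolding t_def by (rule LeastI[of _ "length xs"]) simp
  have le: "t \<le> s" if "sorted (drop s xs)" for s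
    unfolding t_def using that by (rule Least_le)
  have "sorted (drop s xs)" if "t \<le> s" for s
    using sorted_wrt_drop[OF t, of "s - t"] that by simp
  then have "sites xs = {t..length xs}" using le by (auto simp: sites_def)
  then show ?thesis using le[of "length xs"] by auto
qed

definition insert_at :: "nat \<Rightarrow> nat \<Rightarrow> nat list \<Rightarrow> nat list" where
  "insert_at N t xs = take t xs @ N # drop t xs"

text \<open>A maximum placed at the end keeps all sites and adds one behind itself. Placed earlier,
  it creates a descent with its right neighbour, so only the positions to its right remain
  sites.\<close>

lemma card_sites_insert_at:
  assumes "\<forall>x\<in>set xs. x < N" "t \<in> sites xs"
  shows "card (sites (insert_at N t xs)) =
    (if t = length xs then Suc (card (sites xs)) else Suc (length xs) - t)"
proof -
  obtain t0 where t0: "t0 \<le> length xs" "sites xs = {t0..length xs}" using sites_interval by blast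
  have t: "t \<le> length xs" "sorted (drop t xs)" using assms by (auto simp: sites_def)
  show ?thesis
  proof (cases "t = length xs")
    case True
    have "sites (insert_at N t xs) = insert (Suc (length xs)) (sites xs)"
      using assms(1) True
      by (auto simp: sites_def insert_at_def sorted_append le_Suc_eq less_imp_le dest!: in_set_dropD)
    moreover have "Suc (length xs) \<notin> sites xs" by (auto simp: sites_def)
    ultimately show ?thesis using True by simp
  next
    case False
    then have lt: "t < length xs" using t by simp
    have "sites (insert_at N t xs) = {Suc t..Suc (length xs)}"
    proof (intro equalityI subsetI)
      fix s assume s: "s \<in> sites (insert_at N t xs)"
      have "\<not> s \<le> t"
      proof
        assume "s \<le> t"
        then have "sorted (N # drop t xs)"
        proof -
          have "drop s (insert_at N t xs) = drop s (take t xs) @ N # drop t xs"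
            using \<open>s \<le> t\<close> t(1) by (simp add: insert_at_def)
          moreover have "sorted (drop s (insert_at N t xs))" using s by (simp add: sites_def)
          ultimately show ?thesis by (simp only: sorted_append)
        qed
        moreover have "xs ! t \<in> set (drop t xs)" using lt by (metis Cons_nth_drop_Suc list.set_intros(1))
        ultimately show False using assms(1) lt by (metis linorder_not_less nth_mem sorted_wrt.simps(2))
      qed
      then show "s \<in> {Suc t..Suc (length xs)}" using s t by (auto simp: sites_def insert_at_def)
    next
      fix s assume s: "s \<in> {Suc t..Suc (length xs)}"
      then obtain u where "s = Suc u" "t \<le> u" by (cases s) auto
      then have "drop s (insert_at N t xs) = drop u xs"
        using t by (simp add: insert_at_def Suc_diff_le)
      moreover have "sorted (drop u xs)" using sorted_wrt_drop[OF t(2), of "u - t"] \<open>t \<le> u\<close> by simp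
      ultimately show "s \<in> sites (insert_at N t xs)"
        using s t by (simp add: sites_def) (simp add: insert_at_def)
    qed
    then show ?thesis using False by simp
  qed
qed

text \<open>The inverse deletes the maximum \<open>Suc n\<close> and remembers where it
  stood.\<close>

lemma avoiding_lists_Suc:
  "bij_betw (\<lambda>(xs, t). insert_at (Suc n) t xs) (SIGMA xs:avoiding_lists 0 n. sites xs) (avoiding_lists 0 (Suc n))"
proof (rule bij_betwI')
  have max: "\<forall>x\<in>set xs. x < Suc n" "Suc n \<notin> set xs" if "xs \<in> avoiding_lists 0 n" for xs
    using that by (auto simp: avoiding_lists_def)
  fix p assume p: "p \<in> (SIGMA xs:avoiding_lists 0 n. sites xs)"
  obtain xs t where xt: "p = (xs, t)" "xs \<in> avoiding_lists 0 n" "t \<in> sites xs" using p by auto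
  have "distinct (take t xs @ drop t xs)" "set (take t xs @ drop t xs) = {0<..n}" "av321 (take t xs @ drop t xs)"
    using xt by (auto simp: avoiding_lists_def)
  moreover have "set (insert_at (Suc n) t xs) = insert (Suc n) (set (take t xs @ drop t xs))"
    unfolding insert_at_def by (auto simp del: append_take_drop_id)
  moreover have "insert (Suc n) {0<..n} = {0<..Suc n}" "Suc n \<notin> set xs"
    using max(2)[OF xt(2)] by auto
  ultimately have "distinct (insert_at (Suc n) t xs)" "set (insert_at (Suc n) t xs) = {0<..Suc n}"
    using set_take_disj_set_drop_if_distinct[of xs t t] xt(2)
    by (auto simp: insert_at_def avoiding_lists_def dest: in_set_takeD in_set_dropD)
  moreover have "av321 (insert_at (Suc n) t xs)"
    unfolding insert_at_def
    by (subst av321_insert_max) (use max(1)[OF xt(2)] xt in \<open>auto simp: sites_def avoiding_lists_def\<close>)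
  ultimately show "(case p of (xs, t) \<Rightarrow> insert_at (Suc n) t xs) \<in> avoiding_lists 0 (Suc n)"
    using xt by (auto simp: avoiding_lists_def)
  fix q assume q: "q \<in> (SIGMA xs:avoiding_lists 0 n. sites xs)"
  obtain ys s where ys: "q = (ys, s)" "ys \<in> avoiding_lists 0 n" "s \<in> sites ys" using q by auto
  show "((case p of (xs, t) \<Rightarrow> insert_at (Suc n) t xs) = (case q of (xs, t) \<Rightarrow> insert_at (Suc n) t xs)) = (p = q)"
  proof
    assume "(case p of (xs, t) \<Rightarrow> insert_at (Suc n) t xs) = (case q of (xs, t) \<Rightarrow> insert_at (Suc n) t xs)"
    then have "take t xs @ Suc n # drop t xs = take s ys @ Suc n # drop s ys"
      using xt ys by (simp add: insert_at_def)
    moreover have "Suc n \<notin> set (take t xs)" "Suc n \<notin> set (drop t xs)" "Suc n \<notin> set (take s ys)"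
      using max(2)[OF xt(2)] max(2)[OF ys(2)] by (auto dest: in_set_takeD in_set_dropD)
    ultimately have eq: "take t xs = take s ys" "drop t xs = drop s ys"
      by (auto simp: append_Cons_eq_iff)
    then have "xs = ys" by (metis append_take_drop_id)
    moreover have "t \<le> length xs" "s \<le> length ys" using xt ys by (auto simp: sites_def)
    then have "t = s" using arg_cong[OF eq(1), of length] by simp
    ultimately show "p = q" using xt ys by simp
  qed auto
next
  fix zs assume zs: "zs \<in> avoiding_lists 0 (Suc n)"
  then have "Suc n \<in> set zs" by (auto simp: avoiding_lists_def)
  then obtain as bs where ab: "zs = as @ Suc n # bs" by (meson split_list)
  have set: "set (as @ bs) = {0<..n}"
  proof -
    have "insert (Suc n) (set (as @ bs)) = {0<..Suc n}" "Suc n \<notin> set (as @ bs)"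
      using zs ab by (auto simp: avoiding_lists_def)
    moreover have "{0<..Suc n} = insert (Suc n) {0<..n}" by auto
    ultimately show ?thesis by (metis greaterThanAtMost_iff insert_ident not_less_eq_eq order_refl)
  qed
  have "av321 (as @ bs) \<and> sorted bs"
    using zs set unfolding ab avoiding_lists_def by (subst av321_insert_max[symmetric]) auto
  then have "as @ bs \<in> avoiding_lists 0 n" "length as \<in> sites (as @ bs)"
    using zs set ab by (auto simp: avoiding_lists_def sites_def)
  moreover have "zs = insert_at (Suc n) (length as) (as @ bs)"
    by (simp add: ab insert_at_def)
  ultimately show "\<exists>p\<in>(SIGMA xs:avoiding_lists 0 n. sites xs). zs = (case p of (xs, t) \<Rightarrow> insert_at (Suc n) t xs)"
    by (intro bexI[of _ "(as @ bs, length as)"]) auto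
qed

text \<open>With s sites, insertion before the end yields children with 2, ..., s sites and
  insertion at the end one with s + 1; these are the summands of \<open>ballot_sum\<close>.\<close>

lemma sum_ballot_children:
  assumes "xs \<in> avoiding_lists 0 n"
  shows "(\<Sum>t\<in>sites xs. ballot (card (sites (insert_at (Suc n) t xs))) g) = ballot (card (sites xs)) (Suc g)"
proof -
  have len: "length xs = n" using assms avoiding_lists_length by auto
  have max: "\<forall>x\<in>set xs. x < Suc n" using assms by (auto simp: avoiding_lists_def)
  obtain t0 where t0: "t0 \<le> n" "sites xs = {t0..n}" using sites_interval[of xs] len by auto
  have "(\<Sum>t\<in>sites xs. ballot (card (sites (insert_at (Suc n) t xs))) g) =
      (\<Sum>t\<in>{t0..n}. ballot (if t = n then Suc (Suc n - t0) else Suc n - t) g)"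
    using card_sites_insert_at[OF max] t0 len by (intro sum.cong) auto
  also have "\<dots> = (\<Sum>t\<in>{t0..<n}. ballot (Suc n - t) g) + ballot (Suc (Suc n - t0)) g"
    using t0(1) by (subst atLeastLessThanSuc_atLeastAtMost[symmetric])
      (simp add: sum.atLeastLessThan_Suc)
  also have "(\<Sum>t\<in>{t0..<n}. ballot (Suc n - t) g) = (\<Sum>j<n - t0. ballot (Suc (Suc j)) g)"
    by (rule sum.reindex_bij_witness[of _ "\<lambda>j. n - Suc j" "\<lambda>t. n - Suc t"])
      (auto simp: Suc_diff_le Suc_diff_Suc)
  also have "\<dots> + ballot (Suc (Suc n - t0)) g = (\<Sum>j\<le>n - t0. ballot (Suc (Suc j)) g)"
    using t0(1) by (simp add: lessThan_Suc_atMost[symmetric] Suc_diff_le)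
  also have "\<dots> = ballot (card (sites xs)) (Suc g)"
    using t0 by (simp add: ballot_sum Suc_diff_le del: ballot.simps)
  finally show ?thesis .
qed

text \<open>\<open>ballot k g\<close> counts the descendants g levels below a node with k sites. The
  induction moves one level from g to n.\<close>

lemma card_avoiding_lists_tree:
  "card (avoiding_lists 0 (n + g)) = (\<Sum>xs\<in>avoiding_lists 0 n. ballot (card (sites xs)) g)"
proof (induction g arbitrary: n)
  case (Suc g)
  have "card (avoiding_lists 0 (n + Suc g)) = (\<Sum>xs\<in>avoiding_lists 0 (Suc n). ballot (card (sites xs)) g)"
    using Suc[of "Suc n"] by simp
  also have "\<dots> = (\<Sum>(xs, t)\<in>(SIGMA xs:avoiding_lists 0 n. sites xs). ballot (card (sites (insert_at (Suc n) t xs))) g)"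
    using sum.reindex_bij_betw[OF avoiding_lists_Suc[of n], of "\<lambda>xs. ballot (card (sites xs)) g"]
    by (simp add: case_prod_beta)
  also have "\<dots> = (\<Sum>xs\<in>avoiding_lists 0 n. \<Sum>t\<in>sites xs. ballot (card (sites (insert_at (Suc n) t xs))) g)"
    by (subst sum.Sigma) auto
  also have "\<dots> = (\<Sum>xs\<in>avoiding_lists 0 n. ballot (card (sites xs)) (Suc g))"
    by (intro sum.cong refl sum_ballot_children)
  finally show ?case .
qed simp

lemma card_avoiding_lists: "real (card (avoiding_lists a n)) = catalan n"
proof -
  have "sites [] = {0}" by (auto simp: sites_def)
  then have "card (avoiding_lists 0 n) = ballot 1 n"
    using card_avoiding_lists_tree[of 0 n] by simp
  then show ?thesis using card_avoiding_lists_shift[of a n] ballot_1[of n] by simp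
qed

text \<open>The first-block recursion and the Catalan convolution are the same sum with the same
  known factors \<open>ballot 1 (n - i)\<close>. By induction all terms but the last agree, hence so
  do the last ones.\<close>

lemma card_irred_lists: "real (card (irred_lists a (Suc n))) = catalan n"
proof -
  have av: "card (avoiding_lists 0 n) = ballot 1 n" for n
    using card_avoiding_lists[of 0 n] ballot_1[of n] by simp
  have "card (irred_lists 0 (Suc n)) = ballot 1 n"
  proof (induction n rule: less_induct)
    case (less n)
    have "ballot 1 (Suc n) = (\<Sum>k=1..Suc n. card (irred_lists 0 k) * ballot 1 (Suc n - k))"
      using card_avoiding_lists_decomp[of "Suc n"] by (simp only: av zero_less_Suc)
    also have "\<dots> = (\<Sum>k<Suc n. card (irred_lists 0 (Suc k)) * ballot 1 (n - k))"
      by (simp only: One_nat_def sum.atLeast1_atMost_eq diff_Suc_Suc)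
    finally have "(\<Sum>i<n. ballot 1 i * ballot 1 (n - i)) + ballot 1 n * ballot 1 0 =
        (\<Sum>i<n. card (irred_lists 0 (Suc i)) * ballot 1 (n - i)) + card (irred_lists 0 (Suc n)) * ballot 1 0"
      using ballot_1_conv[of n]
      by (simp only: lessThan_Suc_atMost[symmetric] sum.lessThan_Suc diff_self_eq_0)
    moreover have "(\<Sum>i<n. ballot 1 i * ballot 1 (n - i)) = (\<Sum>i<n. card (irred_lists 0 (Suc i)) * ballot 1 (n - i))"
      using less by (intro sum.cong) auto
    ultimately show ?case by simp
  qed
  then show ?thesis using card_irred_lists_shift[of a "Suc n"] ballot_1[of n] by simp
qed

section \<open>Growth and generating sum of the Catalan numbers\<close>

lemma catalan_pos: "0 < catalan n"
  by (simp add: catalan_def)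

lemma central_binomial_Suc:
  "real (Suc n) * real (2 * Suc n choose Suc n) = 2 * (2 * real n + 1) * real (2 * n choose n)"
proof -
  define p q r where "p = (2 * Suc n choose Suc n)" "q = (Suc (2 * n) choose n)" "r = (2 * n choose n)"
  have "Suc n * p = Suc (Suc (2 * n)) * q"
    using Suc_times_binomial[of n "Suc (2 * n)"] by (simp only: p_q_r_def mult_Suc_right add_2_eq_Suc)
  then have p: "p = 2 * q" by (metis mult.left_commute mult_2 mult_Suc_right add_2_eq_Suc nat_mult_eq_cancel_disj nat.distinct(1) mult.commute)
  have "q = (Suc (2 * n) choose Suc n)"
    unfolding p_q_r_def using binomial_symmetric[of n "Suc (2 * n)"] by (simp add: Suc_diff_le del: binomial_Suc_Suc)
  then have "Suc n * q = Suc (2 * n) * r"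
    using Suc_times_binomial[of n "2 * n"] by (simp only: p_q_r_def)
  then have "Suc n * p = 2 * (2 * n + 1) * r" by (simp add: p)
  then show ?thesis
    unfolding p_q_r_def by (metis (no_types, lifting) of_nat_1 of_nat_add of_nat_mult of_nat_numeral)
qed

lemma catalan_Suc_ratio: "catalan (Suc n) / catalan n = (4 * real n + 2) / (real n + 2)"
proof -
  define p q where "p = real (2 * Suc n choose Suc n)" and "q = real (2 * n choose n)"
  have "q > 0" by (simp add: q_def)
  have "catalan (Suc n) / catalan n = (real (Suc n) * p) / ((real n + 2) * q)"
    by (simp add: catalan_def p_def q_def add.commute)
  also have "real (Suc n) * p = 2 * (2 * real n + 1) * q"
    unfolding p_def q_def by (rule central_binomial_Suc)
  finally show ?thesis using \<open>q > 0\<close> by simp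
qed

lemma catalan_ratio_tendsto: "(\<lambda>n. catalan n / catalan (n + m)) \<longlonglongrightarrow> (1/4) ^ m"
proof (induction m)
  case 0
  show ?case using catalan_pos by (simp add: less_imp_neq[symmetric])
next
  case (Suc m)
  have "(\<lambda>n. (real n + 2) / (4 * real n + 2)) \<longlonglongrightarrow> 1/4" by real_asymp
  then have "(\<lambda>n. catalan n / catalan (Suc n)) \<longlonglongrightarrow> 1/4"
    using catalan_Suc_ratio by (metis (no_types, lifting) ext inverse_divide)
  then have "(\<lambda>n. catalan (n + m) / catalan (Suc (n + m))) \<longlonglongrightarrow> 1/4"
    by (rule LIMSEQ_ignore_initial_segment)
  from tendsto_mult[OF Suc this] show ?case
    using catalan_pos by (simp add: less_imp_neq[symmetric])
qed

text \<open>The terms telescope: each is a decrement of the sequence \<open>(2k choose k) / 4^k\<close>.\<close>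

lemma catalan_sums: "(\<lambda>k. catalan k / (2 * 4 ^ k)) sums 1"
proof -
  define d where "d k = real (2 * k choose k)" for k
  define b where "b k = d k / 4 ^ k" for k
  have c: "catalan k = d k / (real k + 1)" for k by (simp add: catalan_def d_def)
  have rec: "b (Suc k) = b k * (2 * real k + 1) / (2 * real k + 2)" for k
  proof -
    have "d (Suc k) = 2 * (2 * real k + 1) * d k / real (Suc k)"
      using central_binomial_Suc[of k] unfolding d_def[symmetric] by (simp add: eq_divide_eq mult.commute)
    moreover have "2 * real k + 2 = 2 * real (Suc k)" by simp
    ultimately show ?thesis
      unfolding b_def by (simp add: divide_simps algebra_simps del: of_nat_Suc)
  qed
  have step: "catalan k / (2 * 4 ^ k) = b k - b (Suc k)" for k
  proof -
    have "b k - b (Suc k) = b k * (1 - (2 * real k + 1) / (2 * real k + 2))"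
      unfolding rec by (simp add: right_diff_distrib)
    also have "1 - (2 * real k + 1) / (2 * real k + 2) = 1 / (2 * (real k + 1))"
      by (simp add: field_simps)
    finally show ?thesis by (simp add: b_def c)
  qed
  \<comment> \<open>An elementary stand-in for the asymptotics of order 1 / sqrt k. The induction
    step is (2k + 1)(2k + 3) \<le> (2k + 2)^2, and the bound forces \<open>b\<close> to 0.\<close>
  have bound: "b k ^ 2 * (2 * real k + 1) \<le> 1" for k
  proof (induction k)
    case (Suc k)
    have "b (Suc k) ^ 2 * (2 * real (Suc k) + 1) =
        (b k ^ 2 * (2 * real k + 1)) * ((2 * real k + 1) * (2 * real k + 3) / (2 * real k + 2) ^ 2)"
      unfolding rec by (simp add: power2_eq_square)
    also have "\<dots> \<le> 1 * 1"
    proof (intro mult_mono Suc)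
      have "(2 * real k + 1) * (2 * real k + 3) \<le> (2 * real k + 2) ^ 2"
        by (simp add: power2_eq_square algebra_simps)
      moreover have "0 < (2 * real k + 2) ^ 2" by simp
      ultimately show "(2 * real k + 1) * (2 * real k + 3) / (2 * real k + 2) ^ 2 \<le> 1"
        by (subst divide_le_eq_1_pos)
    qed auto
    finally show ?case by simp
  qed (simp add: b_def d_def)
  have "(\<lambda>k. b k ^ 2) \<longlonglongrightarrow> 0"
  proof (rule tendsto_sandwich[of "\<lambda>_. 0" _ _ "\<lambda>k. 1 / (2 * real k + 1)"])
    show "\<forall>\<^sub>F k in sequentially. b k ^ 2 \<le> 1 / (2 * real k + 1)"
      using bound by (simp add: field_simps)
    show "(\<lambda>k. 1 / (2 * real k + 1)) \<longlonglongrightarrow> 0" by real_asymp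
  qed auto
  then have "b \<longlonglongrightarrow> 0"
    using tendsto_real_sqrt[of "\<lambda>k. b k ^ 2" 0] by (simp add: tendsto_rabs_zero_iff)
  then have "(\<lambda>k. b k - b (Suc k)) sums (b 0 - 0)"
    by (rule telescope_sums')
  then show ?thesis by (simp add: step b_def d_def)
qed

section \<open>Permutations of blocks as lists\<close>

lemma contains_321_iff:
  "contains_pattern I \<sigma> [3, 2, 1] \<longleftrightarrow>
     (\<exists>i\<in>I. \<exists>j\<in>I. \<exists>k\<in>I. i < j \<and> j < k \<and> \<sigma> k < \<sigma> j \<and> \<sigma> j < \<sigma> i)" (is "?l \<longleftrightarrow> ?r")
proof
  have three: "{..<3} = {0, 1, 2 :: nat}" by auto
  have all3: "(\<forall>j<3. P j) \<longleftrightarrow> P 0 \<and> P 1 \<and> P (2 :: nat)" for P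
    by (metis One_nat_def numeral_2_eq_2 numeral_3_eq_3 less_Suc_eq not_less0)
  {
    assume ?l
    then obtain \<iota> where \<iota>: "strict_mono_on {..<3} \<iota>" "\<iota> ` {..<3 :: nat} \<subseteq> I"
      "\<forall>j<3. \<forall>k<3. \<sigma> (\<iota> j) < \<sigma> (\<iota> k) \<longleftrightarrow> [3, 2, 1 :: nat] ! j < [3, 2, 1] ! k"
      unfolding contains_pattern_def by (auto simp: numeral_3_eq_3)
    have "\<iota> 0 < \<iota> 1" "\<iota> 1 < \<iota> 2" using \<iota>(1) by (auto simp: strict_mono_on_def)
    moreover have "\<iota> 0 \<in> I" "\<iota> 1 \<in> I" "\<iota> 2 \<in> I" using \<iota>(2) by (auto simp: three)
    moreover have "\<sigma> (\<iota> 1) < \<sigma> (\<iota> 0)" "\<sigma> (\<iota> 2) < \<sigma> (\<iota> 1)" using \<iota>(3) unfolding all3 by auto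
    ultimately show ?r by blast
  }
  {
    assume ?r
    then obtain i j k where ijk: "i \<in> I" "j \<in> I" "k \<in> I" "i < j" "j < k" "\<sigma> k < \<sigma> j" "\<sigma> j < \<sigma> i" by blast
    define \<iota> where "\<iota> = (!) [i, j, k]"
    have "strict_mono_on {..<3} \<iota>" "\<iota> ` {..<3} \<subseteq> I"
      using ijk by (auto simp: three \<iota>_def strict_mono_on_def)
    moreover have "\<forall>j<3. \<forall>k<3. \<sigma> (\<iota> j) < \<sigma> (\<iota> k) \<longleftrightarrow> [3, 2, 1 :: nat] ! j < [3, 2, 1] ! k"
      unfolding all3 using ijk by (auto simp: \<iota>_def)
    ultimately show ?l
      unfolding contains_pattern_def by (intro exI[of _ \<iota>]) (auto simp: numeral_3_eq_3)
  }
qed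

lemma av321_map_upt: "av321 (map \<sigma> [a..<b]) \<longleftrightarrow> \<not> contains_pattern {a..<b} \<sigma> [3, 2, 1]"
proof
  assume av: "av321 (map \<sigma> [a..<b])"
  show "\<not> contains_pattern {a..<b} \<sigma> [3, 2, 1]"
    unfolding contains_321_iff
  proof safe
    fix i j k assume *: "i \<in> {a..<b}" "j \<in> {a..<b}" "k \<in> {a..<b}" "i < j" "j < k" "\<sigma> k < \<sigma> j" "\<sigma> j < \<sigma> i"
    show False
      using av[unfolded av321_iff_nth, rule_format, of "i - a" "j - a" "k - a"] *
      by (auto simp: diff_less_mono)
  qed
next
  assume nc: "\<not> contains_pattern {a..<b} \<sigma> [3, 2, 1]"
  show "av321 (map \<sigma> [a..<b])"
    unfolding av321_iff_nth
  proof (intro allI impI notI)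
    fix i j k assume *: "i < j" "j < k" "k < length (map \<sigma> [a..<b])"
      "map \<sigma> [a..<b] ! k < map \<sigma> [a..<b] ! j \<and> map \<sigma> [a..<b] ! j < map \<sigma> [a..<b] ! i"
    then have "a + i \<in> {a..<b}" "a + j \<in> {a..<b}" "a + k \<in> {a..<b}" "a + i < a + j" "a + j < a + k"
      "\<sigma> (a + k) < \<sigma> (a + j)" "\<sigma> (a + j) < \<sigma> (a + i)" by auto
    then show False using nc unfolding contains_321_iff by blast
  qed
qed

abbreviation listing :: "nat \<Rightarrow> nat \<Rightarrow> (nat \<Rightarrow> nat) \<Rightarrow> nat list" where
  "listing a n \<sigma> \<equiv> map \<sigma> [Suc a..<Suc (a + n)]"

lemma bij_listing: "bij_betw (listing a n) (avoiders {Suc a..a + n} [3, 2, 1]) (avoiding_lists a n)"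
proof (rule bij_betwI')
  have I: "{Suc a..<Suc (a + n)} = {Suc a..a + n}" "{a<..a + n} = {Suc a..a + n}" by auto
  fix \<sigma> assume \<sigma>: "\<sigma> \<in> avoiders {Suc a..a + n} [3, 2, 1]"
  then have p: "\<sigma> permutes {Suc a..a + n}" by (simp add: avoiders_def)
  have "av321 (listing a n \<sigma>)" unfolding av321_map_upt I using \<sigma> by (simp add: avoiders_def)
  then show "listing a n \<sigma> \<in> avoiding_lists a n"
    using permutes_inj_on[OF p] permutes_image[OF p] I
    by (simp add: avoiding_lists_def distinct_map del: upt_Suc)
  fix \<rho> assume "\<rho> \<in> avoiders {Suc a..a + n} [3, 2, 1]"
  then have q: "\<rho> permutes {Suc a..a + n}" by (simp add: avoiders_def)
  show "(listing a n \<sigma> = listing a n \<rho>) = (\<sigma> = \<rho>)"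
  proof
    assume *: "listing a n \<sigma> = listing a n \<rho>"
    then have "\<sigma> i = \<rho> i" if "i \<in> {Suc a..a + n}" for i
      using that unfolding map_eq_conv set_upt I by blast
    then show "\<sigma> = \<rho>"
      using permutes_not_in[OF p] permutes_not_in[OF q] by (metis ext)
  qed simp
next
  have I: "{Suc a..<Suc (a + n)} = {Suc a..a + n}" "{a<..a + n} = {Suc a..a + n}" by auto
  fix xs assume xs: "xs \<in> avoiding_lists a n"
  then have len: "length xs = n" by (rule avoiding_lists_length)
  \<comment> \<open>The list fixes the values on the block only; \<open>permutes\<close> requires
    the identity elsewhere.\<close>
  define \<sigma> where "\<sigma> i = (if i \<in> {Suc a..a + n} then xs ! (i - Suc a) else i)" for i
  have eq: "listing a n \<sigma> = xs"
    by (rule nth_equalityI) (auto simp: len \<sigma>_def simp del: upt_Suc)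
  have "distinct (listing a n \<sigma>)" "set (listing a n \<sigma>) = {Suc a..a + n}"
    unfolding eq using xs by (simp_all only: avoiding_lists_def mem_Collect_eq I)
  then have "bij_betw \<sigma> {Suc a..a + n} {Suc a..a + n}"
    by (simp add: bij_betw_def distinct_map I del: upt_Suc)
  then have "\<sigma> permutes {Suc a..a + n}" by (rule bij_imp_permutes) (auto simp: \<sigma>_def)
  moreover have "\<not> contains_pattern {Suc a..a + n} \<sigma> [3, 2, 1]"
    using av321_map_upt[of \<sigma> "Suc a" "Suc (a + n)"] eq xs I by (simp add: avoiding_lists_def)
  ultimately show "\<exists>\<sigma>\<in>avoiders {Suc a..a + n} [3, 2, 1]. xs = listing a n \<sigma>"
    using eq by (intro bexI[of _ \<sigma>]) (auto simp: avoiders_def)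
qed

section \<open>Block irreducibility as the absence of proper cuts\<close>

lemma block_enat: "block j (enat n) = {j..<j + n}"
  by (auto simp: block_def) (metis add_diff_cancel_left' le_add_diff_inverse nat_add_left_cancel_less)

lemma block_infinity: "block j \<infinity> = {j..}"
  by (auto simp: block_def) (metis le_add_diff_inverse)

text \<open>The definition quantifies over all ways to write the set as a block; a nonempty finite
  interval determines its start and length. Its \<open>k\<close> becomes the prefix length
  \<open>k + 1\<close>.\<close>

lemma block_irreducible_finite:
  assumes "0 < n"
  shows "block_irreducible {Suc a..a + n} \<sigma> \<longleftrightarrow> (\<forall>k. 0 < k \<longrightarrow> k < n \<longrightarrow> \<sigma> ` {Suc a..a + k} \<noteq> {Suc a..a + k})"
    (is "?l \<longleftrightarrow> ?r")
proof
  have I: "{Suc a..a + n} = block (Suc a) (enat n)" by (auto simp: block_enat)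
  {
    assume l: ?l
    show ?r
    proof (intro allI impI)
      fix k assume "0 < k" "k < n"
      with l[unfolded block_irreducible_def, rule_format, OF I, of "k - 1"]
      show "\<sigma> ` {Suc a..a + k} \<noteq> {Suc a..a + k}" by simp
    qed
  }
  assume r: ?r
  show ?l
    unfolding block_irreducible_def
  proof (intro allI impI)
    fix j n' k assume eq: "{Suc a..a + n} = block j n'" and lt: "enat (k + 1) < n'"
    obtain l where l: "n' = enat l"
    proof (cases n')
      case infinity
      then have "finite {j..}" using eq by (metis block_infinity finite_atLeastAtMost)
      then show ?thesis using infinite_Ici by blast
    qed
    then have "{Suc a..<Suc (a + n)} = {j..<j + l}"
      using eq unfolding l block_enat by (simp only: atLeastLessThanSuc_atLeastAtMost)
    then have "j = Suc a" "l = n" using assms atLeastLessThan_inj[of "Suc a" "Suc (a + n)" j "j + l"] lt l by auto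
    then show "\<sigma> ` {j..j + k} \<noteq> {j..j + k}" using r[rule_format, of "Suc k"] lt l by simp
  qed
qed

lemma block_irreducible_infinite:
  "block_irreducible {Suc a..} \<sigma> \<longleftrightarrow> (\<forall>k>0. \<sigma> ` {Suc a..a + k} \<noteq> {Suc a..a + k})" (is "?l \<longleftrightarrow> ?r")
proof
  {
    assume l: ?l
    show ?r
    proof (intro allI impI)
      fix k :: nat assume "0 < k"
      with l[unfolded block_irreducible_def, rule_format, OF block_infinity[symmetric], of "k - 1"]
      show "\<sigma> ` {Suc a..a + k} \<noteq> {Suc a..a + k}" by simp
    qed
  }
  assume r: ?r
  show ?l
    unfolding block_irreducible_def
  proof (intro allI impI)
    fix j n' k assume eq: "{Suc a..} = block j n'"
    have "n' = \<infinity>"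
    proof (cases n')
      case (enat l)
      then have "finite {Suc a..}" using eq by (metis block_enat finite_atLeastLessThan)
      then show ?thesis using infinite_Ici by blast
    qed
    then have "{Suc a..} = {j..}" using eq by (auto simp: block_infinity)
    then have "j = Suc a" by (metis atLeast_eq_iff)
    then show "\<sigma> ` {j..j + k} \<noteq> {j..j + k}" using r[rule_format, of "Suc k"] by simp
  qed
qed

lemma bij_listing_irred:
  assumes "0 < n"
  shows "bij_betw (listing a n) (birr_avoiders {Suc a..a + n} [3, 2, 1]) (irred_lists a n)"
proof -
  have "split_free a (listing a n \<sigma>) \<longleftrightarrow> block_irreducible {Suc a..a + n} \<sigma>" for \<sigma>
  proof -
    have "set (take k (listing a n \<sigma>)) = \<sigma> ` {Suc a..a + k}" if "k < n" for k
    proof -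
      have "take k [Suc a..<Suc (a + n)] = [Suc a..<Suc (a + k)]" using that by (simp add: take_upt del: upt_Suc)
      then show ?thesis by (auto simp: take_map simp del: upt_Suc)
    qed
    moreover have "{a<..a + k} = {Suc a..a + k}" for k by auto
    ultimately show ?thesis
      unfolding split_free_def block_irreducible_finite[OF assms] by (auto simp del: upt_Suc)
  qed
  then have "listing a n ` birr_avoiders {Suc a..a + n} [3, 2, 1] = irred_lists a n"
    unfolding birr_avoiders_def irred_lists_def bij_betw_imp_surj_on[OF bij_listing[of a n], symmetric]
    by (auto simp del: upt_Suc)
  then show ?thesis
    by (intro bij_betw_subset[OF bij_listing]) (auto simp: birr_avoiders_def simp del: upt_Suc)
qed

lemma atLeastAtMost_in_finite_blocks: "0 < n \<Longrightarrow> {Suc a..a + n} \<in> finite_blocks"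
  unfolding finite_blocks_def
  by (rule CollectI, rule exI[of _ "Suc a"], rule exI[of _ n]) (auto simp: block_enat)

section \<open>Weak limits of the uniform measures\<close>

lemma ext_dist_le_2: "ext_dist i j \<le> 2" and ext_dist_nonneg: "0 \<le> ext_dist i j"
  using ext_dist_eq_abs(1)[of i j] ext_dist_eq_abs(2,3)[of i] ext_dist_eq_abs(2,3)[of j]
  by linarith+

text \<open>Finite points are isolated: the sum between \<open>k\<close> and any other point
  contains the index \<open>k\<close>, or a smaller index with a larger weight.\<close>

lemma ext_dist_ge:
  assumes "b \<noteq> enat k"
  shows "(1/2) ^ k \<le> ext_dist (enat k) b"
proof -
  obtain l where l: "min (enat k) b \<le> enat l" "enat l < max (enat k) b" "l \<le> k"
  proof (cases "enat k < b")
    case True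
    then show ?thesis using that[of k] by (simp add: min_def max_def less_imp_le)
  next
    case False
    with assms have "b < enat k" by simp
    then obtain l where "b = enat l" by (cases b) auto
    then show ?thesis using that[of l] \<open>b < enat k\<close> by (simp add: min_def max_def)
  qed
  have "(1/2 :: real) ^ k \<le> (1/2) ^ l" using l by (intro power_decreasing) auto
  also have "\<dots> = (\<Sum>\<^sub>\<infinity>j\<in>{l}. (1/2) ^ j)" by simp
  also have "\<dots> \<le> ext_dist (enat k) b"
    unfolding ext_dist_def using l by (intro infsum_mono2 summable_on_half) auto
  finally show ?thesis .
qed

lemma seq_dist_ge:
  assumes "1 \<le> i"
  shows "(1/2) ^ i * ext_dist (\<sigma> i) (\<rho> i) \<le> seq_dist \<sigma> \<rho>"
proof -
  define f where "f j = (1/2) ^ Suc j * ext_dist (\<sigma> (Suc j)) (\<rho> (Suc j))" for j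
  have "summable (\<lambda>i. (1/2 :: real) ^ Suc i)" by (simp add: summable_geometric)
  then have "summable f"
    using ext_dist_le_2 ext_dist_nonneg
    by (intro summable_comparison_test'[OF summable_mult, of "\<lambda>i. (1/2) ^ Suc i" 0 f 2])
      (auto simp: f_def abs_mult mult.commute intro!: mult_left_mono)
  moreover have "0 \<le> f j" for j by (simp add: f_def ext_dist_nonneg)
  ultimately have "sum f {i - 1} \<le> suminf f" by (intro sum_le_suminf) auto
  moreover have "suminf f = seq_dist \<sigma> \<rho>" unfolding seq_dist_def f_def ..
  ultimately show ?thesis using assms by (simp add: f_def)
qed

text \<open>The radius depends only on the position and the value, not on the sequence. Exchanging
  the two sequences makes it serve the event and its complement alike.\<close>

lemma coordinate_eq:
  assumes "1 \<le> i" "seq_dist \<sigma> \<rho> < (1/2) ^ (i + a)" "\<sigma> i = enat a"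
  shows "\<rho> i = enat a"
proof (rule ccontr)
  assume "\<rho> i \<noteq> enat a"
  then have "(1/2) ^ i * (1/2) ^ a \<le> (1/2) ^ i * ext_dist (\<sigma> i) (\<rho> i)"
    using assms(3) by (intro mult_left_mono) (auto intro: ext_dist_ge)
  also have "\<dots> \<le> seq_dist \<sigma> \<rho>" by (rule seq_dist_ge[OF assms(1)])
  finally show False using assms(2) by (simp add: power_add)
qed

text \<open>These sets have continuous indicators, so their probabilities pass exactly to weak
  limits. Openness is relative to \<open>seqs\<close>.\<close>

definition clopen :: "(nat \<Rightarrow> enat) set \<Rightarrow> bool" where
  "clopen U \<longleftrightarrow> openin seqs.mtopology U \<and> openin seqs.mtopology (seqs - U)"

lemma openin_seqs_uniform:
  assumes "0 < e" "U \<subseteq> seqs" "\<And>\<sigma>. \<sigma> \<in> U \<Longrightarrow> seqs.mball \<sigma> e \<subseteq> U"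
  shows "openin seqs.mtopology U"
  using assms unfolding seqs.openin_mtopology by blast

lemma clopen_coordinate:
  assumes "1 \<le> i"
  shows "clopen {\<sigma> \<in> seqs. \<sigma> i = enat a}"
proof -
  have e: "(0 :: real) < (1/2) ^ (i + a)" by simp
  have "seqs.mball \<sigma> ((1/2) ^ (i + a)) \<subseteq> {\<sigma> \<in> seqs. \<sigma> i = enat a}" if "\<sigma> \<in> seqs" "\<sigma> i = enat a" for \<sigma>
    using coordinate_eq[OF assms] that by (auto simp: seqs.in_mball)
  moreover have "seqs.mball \<sigma> ((1/2) ^ (i + a)) \<subseteq> {\<sigma> \<in> seqs. \<sigma> i \<noteq> enat a}" if "\<sigma> \<in> seqs" "\<sigma> i \<noteq> enat a" for \<sigma>
  proof
    fix \<rho> assume "\<rho> \<in> seqs.mball \<sigma> ((1/2) ^ (i + a))"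
    then have "\<rho> \<in> seqs" "seq_dist \<rho> \<sigma> < (1/2) ^ (i + a)" by (auto simp: seqs.in_mball seqs.commute)
    then show "\<rho> \<in> {\<sigma> \<in> seqs. \<sigma> i \<noteq> enat a}" using coordinate_eq[OF assms, of \<rho> \<sigma> a] that by auto
  qed
  moreover have "seqs - {\<sigma> \<in> seqs. \<sigma> i = enat a} = {\<sigma> \<in> seqs. \<sigma> i \<noteq> enat a}" by auto
  ultimately show ?thesis
    unfolding clopen_def
    by (simp only:) (intro conjI openin_seqs_uniform[OF e]; auto)
qed

lemma clopen_Int: "clopen U \<Longrightarrow> clopen V \<Longrightarrow> clopen (U \<inter> V)"
  unfolding clopen_def by (auto simp: Diff_Int openin_Un)

lemma clopen_seqs: "clopen seqs"
  unfolding clopen_def using openin_topspace[of seqs.mtopology] by simp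

definition cylinder :: "nat list \<Rightarrow> (nat \<Rightarrow> enat) set" where
  "cylinder w = {\<sigma> \<in> seqs. \<forall>i<length w. \<sigma> (Suc i) = enat (w ! i)}"

lemma clopen_cylinder: "clopen (cylinder w)"
proof -
  have "clopen {\<sigma> \<in> seqs. \<forall>i<n. \<sigma> (Suc i) = enat (w ! i)}" for n
  proof (induction n)
    case (Suc n)
    have "{\<sigma> \<in> seqs. \<forall>i<Suc n. \<sigma> (Suc i) = enat (w ! i)} =
        {\<sigma> \<in> seqs. \<forall>i<n. \<sigma> (Suc i) = enat (w ! i)} \<inter> {\<sigma> \<in> seqs. \<sigma> (Suc n) = enat (w ! n)}"
      by (auto simp: less_Suc_eq)
    then show ?case using Suc clopen_coordinate[of "Suc n" "w ! n"] clopen_Int by simp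
  qed (simp add: clopen_seqs)
  then show ?thesis unfolding cylinder_def .
qed

lemma space_seqs_borel [simp]: "space seqs_borel = seqs"
  unfolding borel_on_def by (simp add: space_measure_of_conv)

lemma clopen_in_sets: "clopen U \<Longrightarrow> U \<in> sets seqs_borel"
  unfolding borel_on_def clopen_def
  using openin_subset[of seqs.mtopology] by (subst sets_measure_of) (simp_all add: Collect_mono_iff subset_eq)

lemma weakly_converges_clopen:
  assumes "weakly_converges seqs.mtopology \<nu> \<mu>" "clopen U"
    and "sets \<mu> = sets seqs_borel" "\<And>n. sets (\<nu> n) = sets seqs_borel"
  shows "(\<lambda>n. measure (\<nu> n) U) \<longlonglongrightarrow> measure \<mu> U"
proof -
  have U: "openin seqs.mtopology U" "openin seqs.mtopology (seqs - U)" "U \<subseteq> seqs"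
    using assms(2) openin_subset[of seqs.mtopology U] by (auto simp: clopen_def)
  have "openin seqs.mtopology {x \<in> seqs. indicator U x \<in> V}" for V :: "real set"
  proof -
    have "{x \<in> seqs. indicator U x \<in> V} = (if (1::real) \<in> V then U else {}) \<union> (if (0::real) \<in> V then seqs - U else {})"
      using U(3) by (auto simp: indicator_def split: if_splits)
    then show ?thesis using U(1,2) by auto
  qed
  then have "continuous_map seqs.mtopology euclideanreal (indicator U)"
    by (simp add: continuous_map_def)
  moreover have "bounded (indicator U ` topspace seqs.mtopology :: real set)"
    by (rule boundedI[of _ 1]) (auto simp: indicator_def)
  ultimately have "(\<lambda>n. \<integral>\<sigma>. indicator U \<sigma> \<partial>\<nu> n) \<longlonglongrightarrow> (\<integral>\<sigma>. indicator U \<sigma> \<partial>\<mu> :: real)"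
    using assms(1) unfolding weakly_converges_def by blast
  moreover have "U \<inter> space \<mu> = U" "U \<inter> space (\<nu> n) = U" for n
    using U(3) sets_eq_imp_space_eq[OF assms(3)] sets_eq_imp_space_eq[OF assms(4)] by auto
  ultimately show ?thesis by simp
qed

section \<open>Prefixes and patterns under the uniform measures and in the limit\<close>

lemma perm_seq_in_seqs:
  assumes "\<sigma> permutes {1..n}"
  shows "perm_seq \<sigma> \<in> seqs"
proof -
  have "1 \<le> \<sigma> i" if "1 \<le> i" for i
    using permutes_in_image[OF assms, of i] permutes_not_in[OF assms, of i] that
    by (cases "i \<in> {1..n}") auto
  then show ?thesis
    using permutes_inj[OF assms]
    by (auto simp: seqs_def perm_seq_def inj_on_def inj_def one_enat_def)
qed

lemma avoider_measure_sets [simp]: "sets (avoider_measure \<tau> n) = sets seqs_borel"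
  by (simp add: avoider_measure_def)

lemma measure_avoider_measure:
  assumes "A \<in> sets seqs_borel"
  shows "measure (avoider_measure [3, 2, 1] n) A =
    card {xs \<in> avoiders {1..n} [3, 2, 1]. perm_seq xs \<in> A} / card (avoiders {1..n} [3, 2, 1])"
proof -
  let ?S = "avoiders {1..n} [3, 2, 1]"
  have fin: "finite ?S"
    by (rule finite_subset[OF _ finite_permutations[of "{1..n}"]]) (auto simp: avoiders_def)
  have "perm_seq \<in> measurable (uniform_count_measure ?S) seqs_borel"
    by (rule measurableI) (auto simp: avoiders_def perm_seq_in_seqs space_uniform_count_measure sets_uniform_count_measure)
  then have "measure (avoider_measure [3, 2, 1] n) A = measure (uniform_count_measure ?S) (perm_seq -` A \<inter> ?S)"
    unfolding avoider_measure_def using assms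
    by (simp add: measure_distr space_uniform_count_measure)
  also have "\<dots> = card (perm_seq -` A \<inter> ?S) / card ?S"
    using fin by (simp add: measure_uniform_count_measure)
  also have "perm_seq -` A \<inter> ?S = {xs \<in> ?S. perm_seq xs \<in> A}" by auto
  finally show ?thesis .
qed

lemma avoider_measure_cylinder:
  assumes w: "w \<in> avoiding_lists 0 m" and "m \<le> n"
  shows "measure (avoider_measure [3, 2, 1] n) (cylinder w) = catalan (n - m) / catalan n"
proof -
  let ?S = "avoiders {1..n} [3, 2, 1]"
  have len: "length w = m" using w by (rule avoiding_lists_length)
  have bij: "bij_betw (listing 0 n) ?S (avoiding_lists 0 n)"
    using bij_listing[of 0 n] by (simp add: numeral_eq_Suc)
  have iff: "perm_seq \<sigma> \<in> cylinder w \<longleftrightarrow> take m (listing 0 n \<sigma>) = w" if "\<sigma> \<in> ?S" for \<sigma>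
  proof -
    have "take m (listing 0 n \<sigma>) = w \<longleftrightarrow> (\<forall>i<m. \<sigma> (Suc i) = w ! i)"
      using len \<open>m \<le> n\<close> by (auto simp: list_eq_iff_nth_eq simp del: upt_Suc)
    then show ?thesis
      using perm_seq_in_seqs[of \<sigma> n] that len by (auto simp: cylinder_def avoiders_def perm_seq_def)
  qed
  have "card {\<sigma> \<in> ?S. perm_seq \<sigma> \<in> cylinder w} = card (listing 0 n ` {\<sigma> \<in> ?S. perm_seq \<sigma> \<in> cylinder w})"
    by (rule card_image[symmetric], rule inj_on_subset[OF bij_betw_imp_inj_on[OF bij]]) auto
  also have "listing 0 n ` {\<sigma> \<in> ?S. perm_seq \<sigma> \<in> cylinder w} = {xs \<in> avoiding_lists 0 n. take m xs = w}"
    using iff bij_betw_imp_surj_on[OF bij, symmetric] by (auto simp del: upt_Suc)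
  also have "\<dots> = (\<lambda>v. w @ v) ` avoiding_lists m (n - m)"
  proof safe
    fix xs assume "xs \<in> avoiding_lists 0 n" "w = take m xs"
    then have "drop m xs \<in> avoiding_lists m (n - m)"
      using append_in_avoiding_lists[OF w, of "drop m xs" "n - m"] \<open>m \<le> n\<close> by simp
    then show "xs \<in> (\<lambda>v. take m xs @ v) ` avoiding_lists m (n - m)"
      by (intro image_eqI[of _ _ "drop m xs"]) simp_all
  qed (use append_in_avoiding_lists[OF w, of _ "n - m"] \<open>m \<le> n\<close> len in auto)
  also have "card \<dots> = card (avoiding_lists m (n - m))" by (rule card_image) (simp add: inj_on_def)
  finally have "card {\<sigma> \<in> ?S. perm_seq \<sigma> \<in> cylinder w} = card (avoiding_lists m (n - m))" .
  moreover have "card ?S = card (avoiding_lists 0 n)" by (rule bij_betw_same_card[OF bij])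
  ultimately show ?thesis
    by (simp only: measure_avoider_measure[OF clopen_in_sets[OF clopen_cylinder]] card_avoiding_lists)
qed

text \<open>Positions and finite values are prescribed, which makes the event clopen and leaves only
  countably many such events to exclude.\<close>

definition pattern_at :: "nat \<Rightarrow> nat \<Rightarrow> nat \<Rightarrow> nat \<Rightarrow> nat \<Rightarrow> nat \<Rightarrow> (nat \<Rightarrow> enat) set" where
  "pattern_at i j k a b c = {\<sigma> \<in> seqs. \<sigma> i = enat a \<and> \<sigma> j = enat b \<and> \<sigma> k = enat c}"

lemma clopen_pattern_at:
  assumes "1 \<le> i" "1 \<le> j" "1 \<le> k"
  shows "clopen (pattern_at i j k a b c)"
proof -
  have "pattern_at i j k a b c =
      {\<sigma> \<in> seqs. \<sigma> i = enat a} \<inter> {\<sigma> \<in> seqs. \<sigma> j = enat b} \<inter> {\<sigma> \<in> seqs. \<sigma> k = enat c}"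
    by (auto simp: pattern_at_def)
  then show ?thesis using assms by (simp add: clopen_Int clopen_coordinate)
qed

text \<open>The embedded permutation continues as the identity, so positions beyond n need an
  argument. If k > n then c = k, while the larger value \<open>a\<close> at i is at most n or equals
  i, in both cases less than k.\<close>

lemma avoider_measure_pattern:
  assumes "1 \<le> i" "i < j" "j < k" "c < b" "b < a"
  shows "measure (avoider_measure [3, 2, 1] n) (pattern_at i j k a b c) = 0"
proof -
  have no: False if \<sigma>: "\<sigma> \<in> avoiders {1..n} [3, 2, 1]" and "perm_seq \<sigma> \<in> pattern_at i j k a b c" for \<sigma>
  proof -
    have v: "\<sigma> i = a" "\<sigma> j = b" "\<sigma> k = c"
      using that(2) assms by (auto simp: pattern_at_def perm_seq_def)
    have p: "\<sigma> permutes {1..n}" and nc: "\<not> contains_pattern {1..n} \<sigma> [3, 2, 1]"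
      using \<sigma> by (auto simp: avoiders_def)
    have "\<not> k \<le> n"
    proof
      assume "k \<le> n"
      then have "i \<in> {1..n}" "j \<in> {1..n}" "k \<in> {1..n}" using assms by auto
      moreover have "\<sigma> k < \<sigma> j" "\<sigma> j < \<sigma> i" using v assms by auto
      ultimately show False using nc assms(2,3) unfolding contains_321_iff by blast
    qed
    then have "c = k" using v permutes_not_in[OF p, of k] by auto
    then show False
      using v assms permutes_in_image[OF p, of i] permutes_not_in[OF p, of i] \<open>\<not> k \<le> n\<close>
      by (cases "i \<in> {1..n}") auto
  qed
  then have none: "{xs \<in> avoiders {1..n} [3, 2, 1]. perm_seq xs \<in> pattern_at i j k a b c} = {}" by auto
  show ?thesis
    using assms
    by (subst measure_avoider_measure[OF clopen_in_sets[OF clopen_pattern_at]])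
      (simp_all only: none, auto)
qed

locale avoider_limit = prob_space \<mu> for \<mu> :: "(nat \<Rightarrow> enat) measure" +
  fixes r :: "nat \<Rightarrow> nat"
  assumes sets_limit: "sets \<mu> = sets seqs_borel"
    and strict_mono_r: "strict_mono r"
    and limit: "weakly_converges seqs.mtopology (\<lambda>k. avoider_measure [3, 2, 1] (r k)) \<mu>"
begin

lemma space_limit [simp]: "space \<mu> = seqs"
  using sets_eq_imp_space_eq[OF sets_limit] by simp

lemma clopen_event: "clopen U \<Longrightarrow> U \<in> events"
  using clopen_in_sets sets_limit by blast

lemma prob_cylinder:
  assumes w: "w \<in> avoiding_lists 0 m"
  shows "prob (cylinder w) = (1/4) ^ m"
proof -
  have "(\<lambda>n. catalan n / catalan (n + m)) \<longlonglongrightarrow> (1/4) ^ m" by (rule catalan_ratio_tendsto)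
  then have "(\<lambda>n. catalan (n - m) / catalan n) \<longlonglongrightarrow> (1/4) ^ m"
    by (rule_tac LIMSEQ_offset[of _ m]) simp
  then have "(\<lambda>k. catalan (r k - m) / catalan (r k)) \<longlonglongrightarrow> (1/4) ^ m"
    using LIMSEQ_subseq_LIMSEQ[OF _ strict_mono_r] by (fastforce simp: o_def)
  moreover have "\<forall>\<^sub>F k in sequentially. catalan (r k - m) / catalan (r k) =
      measure (avoider_measure [3, 2, 1] (r k)) (cylinder w)"
    using eventually_ge_at_top[of m]
  proof eventually_elim
    case (elim k)
    then have "m \<le> r k" using strict_mono_imp_increasing[OF strict_mono_r, of k] by simp
    then show ?case using avoider_measure_cylinder[OF w] by simp
  qed
  ultimately have "(\<lambda>k. measure (avoider_measure [3, 2, 1] (r k)) (cylinder w)) \<longlonglongrightarrow> (1/4) ^ m"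
    by (rule Lim_transform_eventually)
  with weakly_converges_clopen[OF limit clopen_cylinder sets_limit] show ?thesis
    by (metis LIMSEQ_unique avoider_measure_sets)
qed

text \<open>Every prescribed occurrence is a clopen event of probability zero along the sequence,
  hence null in the limit. Avoidance is thus obtained for finite values.\<close>

lemma AE_avoids:
  "AE \<sigma> in \<mu>. \<forall>i j k a b c. 1 \<le> i \<longrightarrow> i < j \<longrightarrow> j < k \<longrightarrow> c < b \<longrightarrow> b < a \<longrightarrow>
     \<not> (\<sigma> i = enat a \<and> \<sigma> j = enat b \<and> \<sigma> k = enat c)"
  unfolding AE_all_countable
proof (intro allI)
  fix i j k a b c :: nat
  show "AE \<sigma> in \<mu>. 1 \<le> i \<longrightarrow> i < j \<longrightarrow> j < k \<longrightarrow> c < b \<longrightarrow> b < a \<longrightarrow>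
     \<not> (\<sigma> i = enat a \<and> \<sigma> j = enat b \<and> \<sigma> k = enat c)"
  proof (cases "1 \<le> i \<and> i < j \<and> j < k \<and> c < b \<and> b < a")
    case True
    have cl: "clopen (pattern_at i j k a b c)" using True by (intro clopen_pattern_at) auto
    have "(\<lambda>n. 0) \<longlonglongrightarrow> prob (pattern_at i j k a b c)"
      using weakly_converges_clopen[OF limit cl sets_limit] avoider_measure_pattern True by simp
    then have "prob (pattern_at i j k a b c) = 0" by (simp add: LIMSEQ_const_iff)
    then have "AE \<sigma> in \<mu>. \<sigma> \<notin> pattern_at i j k a b c"
      using clopen_event[OF cl] prob_eq_0 by blast
    then show ?thesis
      by (rule AE_mp) (auto simp: pattern_at_def intro!: AE_I2)
  qed auto
qed

end

text \<open>For a complete prefix \<open>w\<close> this says that the last split point is its end.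
  Infinitely many lengths are restricted, so weak convergence gives no direct value for its
  probability.\<close>

definition last_split :: "nat list \<Rightarrow> (nat \<Rightarrow> enat) set" where
  "last_split w = {\<sigma> \<in> cylinder w. \<forall>m>length w. \<sigma> ` {1..m} \<noteq> enat ` {1..m}}"

lemma image_eq_cylinder:
  assumes "\<sigma> \<in> seqs" "\<sigma> ` {1..m} = enat ` {1..m}"
  obtains w where "distinct w" "set w = {0<..m}" "length w = m" "\<sigma> \<in> cylinder w"
proof -
  define w where "w = map (\<lambda>i. the_enat (\<sigma> i)) [1..<Suc m]"
  have ex: "\<exists>a. \<sigma> i = enat a" if "i \<in> {1..m}" for i
    using assms(2) that by (metis image_iff image_eqI)
  then have eq: "\<sigma> i = enat (the_enat (\<sigma> i))" if "i \<in> {1..m}" for i using that by force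
  have "inj_on \<sigma> {1..m}"
    by (rule inj_on_subset[of \<sigma> "{i \<in> {1..}. \<sigma> i \<noteq> \<infinity>}"]) (use assms(1) ex in \<open>auto simp: seqs_def\<close>)
  then have inj: "inj_on (\<lambda>i. the_enat (\<sigma> i)) {1..m}"
    using eq unfolding inj_on_def by metis
  have I: "set [1..<Suc m] = {1..m}" by (simp only: set_upt atLeastLessThanSuc_atLeastAtMost)
  have "distinct w" unfolding w_def distinct_map I using inj by simp
  moreover have "enat ` set w = \<sigma> ` {1..m}"
    unfolding w_def set_map I image_image by (rule image_cong) (simp_all add: eq[symmetric])
  then have "enat ` set w = enat ` {1..m}" using assms(2) by simp
  moreover have "inj enat" by (simp add: inj_def)
  moreover have "{1..m} = {0<..m}" by auto
  ultimately have "distinct w" "set w = {0<..m}" by (simp_all only: inj_image_eq_iff)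
  moreover have "length w = m" by (simp add: w_def)
  moreover have "\<sigma> \<in> cylinder w"
    unfolding cylinder_def using assms(1) by (auto simp: w_def eq[symmetric] simp del: upt_Suc)
  ultimately show ?thesis using that by blast
qed

lemma cylinder_image: "\<sigma> \<in> cylinder w \<Longrightarrow> k \<le> length w \<Longrightarrow> \<sigma> ` {1..k} = enat ` set (take k w)"
proof -
  assume a: "\<sigma> \<in> cylinder w" "k \<le> length w"
  have "{1..k} = Suc ` {..<k}" by (simp only: image_Suc_lessThan One_nat_def)
  moreover have "set (take k w) = (!) w ` {..<k}" using a(2) by (auto simp: nth_image[symmetric] lessThan_atLeast0)
  ultimately show ?thesis using a by (auto simp: cylinder_def image_image intro!: image_cong)
qed

text \<open>A split at m is seen on the first m coordinates, so it is a countable union of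
  cylinders.\<close>

lemma last_split_sets: "last_split w \<in> sets seqs_borel"
proof -
  have "{\<sigma> \<in> seqs. \<sigma> ` {1..m} = enat ` {1..m}} = (\<Union>v\<in>{v. distinct v \<and> set v = {0<..m}}. cylinder v)" for m
  proof (intro equalityI subsetI)
    fix \<sigma> assume "\<sigma> \<in> (\<Union>v\<in>{v. distinct v \<and> set v = {0<..m}}. cylinder v)"
    then obtain v where v: "distinct v" "set v = {0<..m}" "\<sigma> \<in> cylinder v" by blast
    then have "length v = m" using distinct_card[of v] by simp
    then have "\<sigma> ` {1..m} = enat ` {1..m}" using cylinder_image[OF v(3), of m] v(2) by auto
    then show "\<sigma> \<in> {\<sigma> \<in> seqs. \<sigma> ` {1..m} = enat ` {1..m}}" using v by (auto simp: cylinder_def)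
  next
    fix \<sigma> assume "\<sigma> \<in> {\<sigma> \<in> seqs. \<sigma> ` {1..m} = enat ` {1..m}}"
    then have "\<sigma> \<in> seqs" "\<sigma> ` {1..m} = enat ` {1..m}" by simp_all
    then obtain v where "distinct v" "set v = {0<..m}" "\<sigma> \<in> cylinder v" by (rule image_eq_cylinder)
    then show "\<sigma> \<in> (\<Union>v\<in>{v. distinct v \<and> set v = {0<..m}}. cylinder v)" by blast
  qed
  then have [measurable]: "{\<sigma> \<in> seqs. \<sigma> ` {1..m} = enat ` {1..m}} \<in> sets seqs_borel" for m
    by (auto intro!: clopen_in_sets[OF clopen_cylinder])
  have "last_split w = cylinder w - (\<Union>m\<in>{length w<..}. {\<sigma> \<in> seqs. \<sigma> ` {1..m} = enat ` {1..m}})"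
    by (auto simp: last_split_def cylinder_def)
  then show ?thesis using clopen_in_sets[OF clopen_cylinder] by (auto intro!: sets.Diff sets.countable_UN'' simp del: One_nat_def)
qed

context avoider_limit
begin

lemma last_split_event: "last_split w \<in> events"
  using last_split_sets sets_limit by blast

text \<open>
  A lower bound suffices: the bounds of all decompositions add up to 1, which forces equality.
\<close>

lemma prob_last_split_ge:
  assumes w: "w \<in> avoiding_lists 0 m"
  shows "(1/4) ^ m / 2 \<le> prob (last_split w)"
proof -
  have len: "length w = m" using w by (rule avoiding_lists_length)
  have setw: "set w = {0<..m}" using w by (simp add: avoiding_lists_def)
  \<comment> \<open>The next irreducible block after \<open>w\<close> has size
    \<open>Suc k\<close>.\<close>
  define A where "A k = (\<Union>b\<in>irred_lists m (Suc k). cylinder (w @ b))" for k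
  have A_ev: "A k \<in> events" for k
    unfolding A_def by (intro sets.finite_UN finite_irred_lists clopen_event clopen_cylinder)
  \<comment> \<open>A later split exhibits a longer complete prefix; the first irreducible block
    after \<open>w\<close> inside it puts \<sigma> in some \<open>A k\<close>. The inclusion is
    almost sure because that block has to avoid 321.\<close>
  have cover: "AE \<sigma> in \<mu>. \<sigma> \<in> cylinder w \<longrightarrow> \<sigma> \<in> last_split w \<union> (\<Union>k. A k)"
    using AE_avoids AE_space
  proof eventually_elim
    case (elim \<sigma>)
    show ?case
    proof
      assume \<sigma>: "\<sigma> \<in> cylinder w"
      show "\<sigma> \<in> last_split w \<union> (\<Union>k. A k)"
      proof (cases "\<sigma> \<in> last_split w")
        case False
        then obtain m' where m': "m < m'" "\<sigma> ` {1..m'} = enat ` {1..m'}"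
          using \<sigma> len by (auto simp: last_split_def)
        then obtain v where v: "distinct v" "set v = {0<..m'}" "length v = m'" "\<sigma> \<in> cylinder v"
          using image_eq_cylinder elim(2) by (metis space_limit)
        have av: "av321 v"
          unfolding av321_iff_nth
        proof (intro allI impI)
          fix i j k assume "i < j" "j < k" "k < length v"
          with elim(1)[rule_format, of "Suc i" "Suc j" "Suc k" "v ! k" "v ! j" "v ! i"] v(4)
          show "\<not> (v ! k < v ! j \<and> v ! j < v ! i)" by (auto simp: cylinder_def)
        qed
        have vw: "take m v = w"
          using \<sigma> v m' len by (intro nth_equalityI) (auto simp: cylinder_def)
        have v_in: "v \<in> avoiding_lists 0 m'" using v av by (simp add: avoiding_lists_def)
        define u where "u = drop m v"
        have u: "u \<in> avoiding_lists m (m' - m)" "v = w @ u"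
          using take_in_avoiding_lists(2)[OF v_in, of m] m' vw setw by (auto simp: u_def)
        then have "length u = m' - m" using avoiding_lists_length by blast
        then obtain l where l: "0 < l" "l \<le> m' - m" "set (take l u) = {m<..m + l}" "split_free m (take l u)"
          using first_irred_block[of "m' - m" u m] u m' by (auto simp: avoiding_lists_def)
        have "take l u \<in> irred_lists m l"
          using take_in_avoiding_lists(1)[OF u(1) l(2,3)] l(4) by (simp add: irred_lists_def)
        moreover have "\<sigma> \<in> cylinder (w @ take l u)"
        proof -
          have "w @ take l u = take (m + l) v" using u(2) len by simp
          then show ?thesis using v(4) by (auto simp: cylinder_def)
        qed
        ultimately show ?thesis using l(1) by (auto simp: A_def intro!: exI[of _ "l - 1"] bexI[of _ "take l u"])
      qed simp
    qed
  qed
  \<comment> \<open>There are C_k blocks, each of cost 4^(-m-k-1). The bound is arranged as half of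
    4^(-m) times the k-th term of a series with sum 1.\<close>
  have sum_bound: "prob (A k) \<le> (1/4) ^ m / 2 * (catalan k / (2 * 4 ^ k))" for k
  proof -
    have "prob (A k) \<le> (\<Sum>b\<in>irred_lists m (Suc k). prob (cylinder (w @ b)))"
      unfolding A_def by (rule finite_measure_subadditive_finite) (auto intro: clopen_event clopen_cylinder)
    also have "\<dots> = (\<Sum>b\<in>irred_lists m (Suc k). (1/4) ^ (m + Suc k))"
      using append_in_avoiding_lists[OF w, of _ "Suc k"] by (intro sum.cong refl prob_cylinder) (auto simp: irred_lists_def)
    also have "\<dots> = catalan k * (1/4) ^ (m + Suc k)" by (simp add: card_irred_lists)
    also have "\<dots> = (1/4) ^ m / 2 * (catalan k / (2 * 4 ^ k))" by (simp add: power_add field_simps)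
    finally show ?thesis .
  qed
  have sums: "(\<lambda>k. (1/4 :: real) ^ m / 2 * (catalan k / (2 * 4 ^ k))) sums ((1/4) ^ m / 2 * 1)"
    by (rule sums_mult[OF catalan_sums])
  have summable: "summable (\<lambda>k. prob (A k))"
    by (rule summable_comparison_test'[OF sums_summable[OF sums], of 0]) (use sum_bound in auto)
  have "(1/4) ^ m = prob (cylinder w)" by (rule prob_cylinder[OF w, symmetric])
  also have "\<dots> \<le> prob (last_split w \<union> (\<Union>k. A k))"
    using cover by (intro finite_measure_mono_AE) (auto intro: A_ev last_split_event)
  also have "\<dots> \<le> prob (last_split w) + prob (\<Union>k. A k)"
    by (intro measure_Un_le) (auto intro: A_ev last_split_event)
  also have "prob (\<Union>k. A k) \<le> (\<Sum>k. prob (A k))"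
    by (rule finite_measure_subadditive_countably[OF _ summable]) (auto intro: A_ev)
  also have "\<dots> \<le> (\<Sum>k. (1/4 :: real) ^ m / 2 * (catalan k / (2 * 4 ^ k)))"
    by (rule suminf_le[OF sum_bound summable sums_summable[OF sums]])
  also have "\<dots> = (1/4) ^ m / 2" using sums_unique[OF sums] by simp
  finally show ?thesis by simp
qed

end

section \<open>The random block decomposition\<close>

text \<open>The offset grows with each block, so blocks stand at their true positions. Excluding
  empty blocks keeps the decomposition unique, as \<open>[]\<close> is vacuously
  irreducible.\<close>

fun irred_blocks :: "nat \<Rightarrow> nat list list \<Rightarrow> bool" where
  "irred_blocks a [] \<longleftrightarrow> True"
| "irred_blocks a (b # bs) \<longleftrightarrow>
     b \<noteq> [] \<and> b \<in> irred_lists a (length b) \<and> irred_blocks (a + length b) bs"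

lemma irred_blocks_concat: "irred_blocks a bs \<Longrightarrow> concat bs \<in> avoiding_lists a (length (concat bs))"
proof (induction bs arbitrary: a)
  case (Cons b bs)
  have "b \<in> avoiding_lists a (length b)" using Cons by (simp add: irred_lists_def)
  then show ?case using append_in_avoiding_lists[of b a "length b" "concat bs" "length (concat bs)"] Cons by simp
qed simp

lemma irred_blocks_inj:
  "irred_blocks a bs \<Longrightarrow> irred_blocks a cs \<Longrightarrow> concat bs = concat cs \<Longrightarrow> bs = cs"
proof (induction bs arbitrary: a cs)
  case Nil
  then show ?case by (cases cs) auto
next
  case (Cons b bs)
  then obtain c cs' where cs: "cs = c # cs'" by (cases cs) auto
  have "b = c"
    by (rule irred_prefix_unique[of b "concat bs" c "concat cs'" a "length b" "length c"])
      (use Cons.prems cs in auto)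
  then show ?case using Cons.IH[of "a + length b" cs'] Cons.prems cs by auto
qed

lemma last_split_length:
  assumes "\<sigma> \<in> last_split w" "\<sigma> \<in> cylinder v" "set v = {0<..length v}"
  shows "length v \<le> length w"
proof (rule ccontr)
  assume "\<not> length v \<le> length w"
  then have "\<sigma> ` {1..length v} \<noteq> enat ` {1..length v}" using assms(1) by (auto simp: last_split_def)
  moreover have "\<sigma> ` {1..length v} = enat ` {1..length v}"
    using cylinder_image[OF assms(2), of "length v"] assms(3) by auto
  ultimately show False by simp
qed

text \<open>Both prefixes are complete and neither can be longer than the other; equal prefixes have
  equal block lists. This disjointness allows the probabilities to be added.\<close>

lemma last_split_unique:
  assumes "\<sigma> \<in> last_split (concat bs)" "\<sigma> \<in> last_split (concat cs)" "irred_blocks 0 bs" "irred_blocks 0 cs"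
  shows "bs = cs"
proof -
  have set: "set (concat ds) = {0<..length (concat ds)}" if "irred_blocks 0 ds" for ds
    using irred_blocks_concat[OF that] by (simp add: avoiding_lists_def)
  have cylinder: "\<sigma> \<in> cylinder (concat bs)" "\<sigma> \<in> cylinder (concat cs)" using assms by (auto simp: last_split_def)
  have "length (concat bs) = length (concat cs)"
    using last_split_length[OF assms(1) cylinder(2) set] last_split_length[OF assms(2) cylinder(1) set] assms by simp
  moreover from this have "concat bs = concat cs"
    using cylinder by (intro nth_equalityI) (auto simp: cylinder_def)
  ultimately show ?thesis using irred_blocks_inj assms by blast
qed

text \<open>The block listing before concatenation: the boundaries are kept, and blocks are given by
  offset and length instead of endpoints.\<close>

definition pieces ::
    "(nat \<Rightarrow> 'a \<Rightarrow> nat) \<Rightarrow> ('a \<Rightarrow> nat) \<Rightarrow> (nat set \<Rightarrow> 'a \<Rightarrow> nat \<Rightarrow> nat) \<Rightarrow> 'a \<Rightarrow> nat list list" where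
  "pieces X Y \<Phi> \<omega> =
     map (\<lambda>n. listing (partial_sum X n \<omega>) (X (Suc n) \<omega>)
           (\<Phi> {Suc (partial_sum X n \<omega>)..partial_sum X n \<omega> + X (Suc n) \<omega>} \<omega>)) [0..<Y \<omega> - 1]"

lemma partial_sum_Suc: "partial_sum X (Suc n) \<omega> = partial_sum X n \<omega> + X (Suc n) \<omega>"
  by (simp add: partial_sum_def)

lemma partial_sum_0 [simp]: "partial_sum X 0 \<omega> = 0"
  by (simp add: partial_sum_def)

lemma block_listing_eq: "block_listing X Y \<Phi> \<omega> = concat (pieces X Y \<Phi> \<omega>)"
  unfolding block_listing_def pieces_def Let_def by (simp add: partial_sum_Suc del: upt_Suc)

lemma length_block_listing: "length (block_listing X Y \<Phi> \<omega>) = partial_sum X (Y \<omega> - 1) \<omega>"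
proof -
  have "length (concat (map (\<lambda>n. listing (partial_sum X n \<omega>) (X (Suc n) \<omega>) (f n)) [0..<m])) = partial_sum X m \<omega>"
    for m and f :: "nat \<Rightarrow> nat \<Rightarrow> nat"
    by (induction m) (simp_all add: partial_sum_Suc del: upt_Suc, simp add: partial_sum_Suc)
  then show ?thesis unfolding block_listing_eq pieces_def .
qed

section \<open>The law of the random block list\<close>

locale random_blocks = prob_space M for M :: "'a measure" +
  fixes X :: "nat \<Rightarrow> 'a \<Rightarrow> nat" and Y :: "'a \<Rightarrow> nat" and \<Phi> :: "nat set \<Rightarrow> 'a \<Rightarrow> nat \<Rightarrow> nat"
  assumes X_measurable: "\<And>n. 1 \<le> n \<Longrightarrow> X n \<in> measurable M (count_space UNIV)"
    and X_prob: "\<And>n k. 1 \<le> n \<Longrightarrow> prob {\<omega> \<in> space M. X n \<omega> = k + 1} = catalan k / (2 * 4 ^ k)"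
    and Y_measurable: "Y \<in> measurable M (count_space UNIV)"
    and Y_prob: "\<And>k. 1 \<le> k \<Longrightarrow> prob {\<omega> \<in> space M. Y \<omega> = k} = (1/2) ^ k"
    and \<Phi>_measurable: "\<And>I. I \<in> finite_blocks \<Longrightarrow>
      \<Phi> I \<in> measurable M (count_space (birr_avoiders I [3, 2, 1]))"
    and \<Phi>_distr: "\<And>I. I \<in> finite_blocks \<Longrightarrow>
      distr M (count_space (birr_avoiders I [3, 2, 1])) (\<Phi> I) =
        uniform_count_measure (birr_avoiders I [3, 2, 1])"
    and indep: "mutually_independent M X Y \<Phi>"
begin

lemma Suc_X_measurable [measurable]: "X (Suc n) \<in> measurable M (count_space UNIV)"
  by (rule X_measurable) simp

declare Y_measurable [measurable]

lemma partial_sum_measurable [measurable]: "partial_sum X n \<in> measurable M (count_space UNIV)"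
proof (induction n)
  case 0
  have "partial_sum X 0 = (\<lambda>_. 0)" by (auto simp: partial_sum_def)
  then show ?case by simp
next
  case (Suc n)
  note Suc [measurable]
  have "partial_sum X (Suc n) = (\<lambda>\<omega>. partial_sum X n \<omega> + X (Suc n) \<omega>)" by (rule ext) (rule partial_sum_Suc)
  then show ?case by simp
qed

lemma listing_\<Phi>_measurable [measurable]:
  "(\<lambda>\<omega>. listing a n (\<Phi> {Suc a..a + n} \<omega>)) \<in> measurable M (count_space UNIV)"
\<comment> \<open>The empty set is not among the finite blocks, so nothing is assumed about \<Phi>
  there; the listing is then constantly empty.\<close>
proof (cases "n = 0")
  case False
  then have "\<Phi> {Suc a..a + n} \<in> measurable M (count_space (birr_avoiders {Suc a..a + n} [3, 2, 1]))"
    by (intro \<Phi>_measurable atLeastAtMost_in_finite_blocks) simp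
  then show ?thesis by (rule measurable_compose) simp
qed simp

lemma listing_\<Phi>_irred:
  assumes "\<omega> \<in> space M" "0 < n"
  shows "listing a n (\<Phi> {Suc a..a + n} \<omega>) \<in> irred_lists a n"
proof -
  have "\<Phi> {Suc a..a + n} \<omega> \<in> birr_avoiders {Suc a..a + n} [3, 2, 1]"
    using measurable_space[OF \<Phi>_measurable[OF atLeastAtMost_in_finite_blocks[OF assms(2)]] assms(1)] by simp
  then show ?thesis using bij_betw_apply[OF bij_listing_irred[OF assms(2)]] by blast
qed

text \<open>The index of \<Phi> is itself random. Offset and length take countably many values, and
  on each of them a fixed block is used.\<close>

lemma piece_measurable:
  "(\<lambda>\<omega>. listing (partial_sum X n \<omega>) (X (Suc n) \<omega>)
      (\<Phi> {Suc (partial_sum X n \<omega>)..partial_sum X n \<omega> + X (Suc n) \<omega>} \<omega>)) \<in> measurable M (count_space UNIV)"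
proof -
  have "(\<lambda>\<omega>. listing a (X (Suc n) \<omega>) (\<Phi> {Suc a..a + X (Suc n) \<omega>} \<omega>)) \<in> measurable M (count_space UNIV)" for a
    by (rule measurable_compose_countable[OF listing_\<Phi>_measurable Suc_X_measurable])
  then show ?thesis
    by (rule measurable_compose_countable[OF _ partial_sum_measurable])
qed

lemma pieces_measurable: "pieces X Y \<Phi> \<in> measurable M (count_space UNIV)"
proof -
  have "(\<lambda>\<omega>. map (\<lambda>n. listing (partial_sum X n \<omega>) (X (Suc n) \<omega>)
      (\<Phi> {Suc (partial_sum X n \<omega>)..partial_sum X n \<omega> + X (Suc n) \<omega>} \<omega>)) [0..<m]) \<in> measurable M (count_space UNIV)" for m
  proof (induction m)
    case (Suc m)
    have "(\<lambda>\<omega>. xs @ [listing (partial_sum X m \<omega>) (X (Suc m) \<omega>)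
      (\<Phi> {Suc (partial_sum X m \<omega>)..partial_sum X m \<omega> + X (Suc m) \<omega>} \<omega>)]) \<in> measurable M (count_space UNIV)" for xs
      by (rule measurable_compose[OF piece_measurable]) simp
    from measurable_compose_countable[OF this Suc] show ?case
      by (simp only: upt_Suc_append[OF le0] map_append list.map)
  qed simp
  moreover have "(\<lambda>\<omega>. Y \<omega> - 1) \<in> measurable M (count_space UNIV)" by measurable
  ultimately show ?thesis
    unfolding pieces_def[abs_def] by (rule measurable_compose_countable)
qed

text \<open>Valid at every sample point, even where some X vanishes; measurability of the completed
  listing into \<open>seqs\<close> demands this pointwise form.\<close>

lemma pieces_positive_distinct:
  assumes "\<omega> \<in> space M"
  shows "distinct (concat (pieces X Y \<Phi> \<omega>)) \<and> 0 \<notin> set (concat (pieces X Y \<Phi> \<omega>))"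
proof -
  have p: "distinct (listing a n (\<Phi> {Suc a..a + n} \<omega>)) \<and> set (listing a n (\<Phi> {Suc a..a + n} \<omega>)) = {a<..a + n}" for a n
    using listing_\<Phi>_irred[OF assms, of n a]
    by (cases "n = 0") (auto simp: irred_lists_def avoiding_lists_def simp del: upt_Suc)
  have "distinct (concat (map (\<lambda>n. listing (partial_sum X n \<omega>) (X (Suc n) \<omega>)
      (\<Phi> {Suc (partial_sum X n \<omega>)..partial_sum X n \<omega> + X (Suc n) \<omega>} \<omega>)) [0..<m])) \<and>
     set (concat (map (\<lambda>n. listing (partial_sum X n \<omega>) (X (Suc n) \<omega>)
      (\<Phi> {Suc (partial_sum X n \<omega>)..partial_sum X n \<omega> + X (Suc n) \<omega>} \<omega>)) [0..<m])) = {0<..partial_sum X m \<omega>}" for m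
  proof (induction m)
    case (Suc m)
    have "{0<..partial_sum X (Suc m) \<omega>} =
      {0<..partial_sum X m \<omega>} \<union> {partial_sum X m \<omega><..partial_sum X m \<omega> + X (Suc m) \<omega>}"
      by (auto simp: partial_sum_Suc)
    moreover have "{0<..partial_sum X m \<omega>} \<inter> {partial_sum X m \<omega><..partial_sum X m \<omega> + X (Suc m) \<omega>} = {}" by auto
    ultimately show ?case
      using Suc p[of "partial_sum X m \<omega>" "X (Suc m) \<omega>"]
      unfolding upt_Suc_append[OF le0, of m] map_append concat_append distinct_append set_append
      by (simp del: upt_Suc)
  qed simp
  from this[of "Y \<omega> - 1"] show ?thesis unfolding pieces_def by (simp del: upt_Suc)
qed

text \<open>Only probabilities of positive values are given. They exhaust the total mass, so the
  value 0 is null.\<close>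

lemma AE_positive:
  assumes "f \<in> measurable M (count_space UNIV)" "\<And>k. prob {\<omega> \<in> space M. f \<omega> = k + 1} = p k" "p sums 1"
  shows "AE \<omega> in M. (0 :: nat) < f \<omega>"
proof -
  note assms(1) [measurable]
  define A where "A k = {\<omega> \<in> space M. f \<omega> = k + 1}" for k
  have A: "range A \<subseteq> events" by (auto simp: A_def)
  have "disjoint_family A" by (auto simp: A_def disjoint_family_on_def)
  then have "(\<lambda>k. prob (A k)) sums prob (\<Union>k. A k)" using A by (intro finite_measure_UNION)
  then have "prob (\<Union>k. A k) = 1" using assms(2,3) sums_unique2 by (fastforce simp: A_def)
  then have "AE \<omega> in M. \<omega> \<in> (\<Union>k. A k)" using A by (subst (asm) prob_eq_1) auto
  then show ?thesis by (rule AE_mp) (auto simp: A_def)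
qed

lemma AE_X_positive: "AE \<omega> in M. \<forall>n. 0 < X (Suc n) \<omega>"
  unfolding AE_all_countable
  by (intro allI AE_positive[OF _ X_prob catalan_sums] Suc_X_measurable) simp

lemma AE_Y_positive: "AE \<omega> in M. 0 < Y \<omega>"
proof (rule AE_positive[OF Y_measurable Y_prob])
  show "(\<lambda>k. (1/2 :: real) ^ (k + 1)) sums 1" using power_half_series by simp
qed simp

lemma AE_irred_blocks: "AE \<omega> in M. irred_blocks 0 (pieces X Y \<Phi> \<omega>)"
  using AE_X_positive AE_space
proof eventually_elim
  case (elim \<omega>)
  define b where "b n = listing (partial_sum X n \<omega>) (X (Suc n) \<omega>)
      (\<Phi> {Suc (partial_sum X n \<omega>)..partial_sum X n \<omega> + X (Suc n) \<omega>} \<omega>)" for n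
  have irr: "b n \<in> irred_lists (partial_sum X n \<omega>) (X (Suc n) \<omega>)" for n
    unfolding b_def by (rule listing_\<Phi>_irred[OF elim(2)]) (use elim(1) in simp)
  have len: "length (b n) = X (Suc n) \<omega>" for n using irr irred_lists_length by blast
  have "irred_blocks (partial_sum X i \<omega>) (map b [i..<i + n])" for i n
  proof (induction n arbitrary: i)
    case (Suc n)
    have "irred_blocks (partial_sum X i \<omega> + X (Suc i) \<omega>) (map b [Suc i..<i + Suc n])"
      using Suc[of "Suc i"] by (simp add: partial_sum_Suc del: upt_Suc)
    moreover have "b i \<noteq> []" using len[of i] elim(1) by (metis length_0_conv less_irrefl)
    ultimately show ?case using irr[of i] len[of i]
      by (subst upt_conv_Cons) (simp_all del: upt_Suc)
  qed simp
  from this[of 0 "Y \<omega> - 1"] show ?case by (simp add: pieces_def b_def[symmetric] del: upt_Suc)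
qed

text \<open>Once the earlier lengths agree, the random offsets equal those of \<open>bs\<close>;
  \<Phi> is then evaluated at deterministic blocks, as independence requires. The truncated
  \<open>Y \<omega> - 1\<close> does not separate Y = 0 from Y = 1.\<close>

lemma pieces_eq_iff:
  "pieces X Y \<Phi> \<omega> = bs \<longleftrightarrow> Y \<omega> - 1 = length bs \<and> (\<forall>i<length bs. X (Suc i) \<omega> = length (bs ! i) \<and>
     listing (length (concat (take i bs))) (length (bs ! i))
       (\<Phi> {Suc (length (concat (take i bs)))..length (concat (take i bs)) + length (bs ! i)} \<omega>) = bs ! i)"
  (is "?l \<longleftrightarrow> ?r")
proof -
  define b where "b n = listing (partial_sum X n \<omega>) (X (Suc n) \<omega>)
      (\<Phi> {Suc (partial_sum X n \<omega>)..partial_sum X n \<omega> + X (Suc n) \<omega>} \<omega>)" for n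
  have len: "length (b n) = X (Suc n) \<omega>" for n by (simp add: b_def del: upt_Suc)
  have "?l \<longleftrightarrow> Y \<omega> - 1 = length bs \<and> (\<forall>i<length bs. b i = bs ! i)"
    unfolding pieces_def b_def[symmetric] by (auto simp: list_eq_iff_nth_eq)
  also have "\<dots> \<longleftrightarrow> Y \<omega> - 1 = length bs \<and> (\<forall>i<length bs. X (Suc i) \<omega> = length (bs ! i) \<and> b i = bs ! i)"
    using len by metis
  also have "\<dots> \<longleftrightarrow> ?r"
  proof (rule conj_cong[OF refl])
    have "partial_sum X i \<omega> = length (concat (take i bs))"
      if "\<forall>i<length bs. X (Suc i) \<omega> = length (bs ! i)" "i \<le> length bs" for i
      using that(2)
    proof (induction i)
      case (Suc i)
      then show ?case using that(1) by (simp add: partial_sum_Suc take_Suc_conv_app_nth)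
    qed simp
    then show "(\<forall>i<length bs. X (Suc i) \<omega> = length (bs ! i) \<and> b i = bs ! i) \<longleftrightarrow>
      (\<forall>i<length bs. X (Suc i) \<omega> = length (bs ! i) \<and>
     listing (length (concat (take i bs))) (length (bs ! i))
       (\<Phi> {Suc (length (concat (take i bs)))..length (concat (take i bs)) + length (bs ! i)} \<omega>) = bs ! i)"
      unfolding b_def by (metis (no_types, lifting) less_imp_le)
  qed
  finally show ?thesis .
qed

lemma prob_listing_\<Phi>:
  assumes "0 < n" "b \<in> irred_lists a n"
  shows "prob {\<omega> \<in> space M. listing a n (\<Phi> {Suc a..a + n} \<omega>) = b} = 1 / catalan (n - 1)"
proof -
  let ?I = "{Suc a..a + n}"
  let ?B = "birr_avoiders ?I [3, 2, 1]"
  have bij: "bij_betw (listing a n) ?B (irred_lists a n)" by (rule bij_listing_irred[OF assms(1)])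
  have fin: "finite ?B" using bij_betw_finite[OF bij] by simp
  have fb: "?I \<in> finite_blocks" by (rule atLeastAtMost_in_finite_blocks[OF assms(1)])
  have "b \<in> listing a n ` ?B"
    using assms(2) bij_betw_imp_surj_on[OF bij] by (simp only:)
  then obtain \<sigma> where \<sigma>: "\<sigma> \<in> ?B" "listing a n \<sigma> = b" by (rule imageE) (simp only:)
  have "listing a n (\<Phi> ?I \<omega>) = b \<longleftrightarrow> \<Phi> ?I \<omega> = \<sigma>" if "\<omega> \<in> space M" for \<omega>
    using inj_on_eq_iff[OF bij_betw_imp_inj_on[OF bij], of "\<Phi> ?I \<omega>" \<sigma>] \<sigma>
      measurable_space[OF \<Phi>_measurable[OF fb] that] by (simp only: space_count_space)
  then have "prob {\<omega> \<in> space M. listing a n (\<Phi> ?I \<omega>) = b} = prob (\<Phi> ?I -` {\<sigma>} \<inter> space M)"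
    by (intro arg_cong[of _ _ prob]) blast
  also have "\<dots> = measure (distr M (count_space ?B) (\<Phi> ?I)) {\<sigma>}"
    using \<sigma>(1) by (subst measure_distr[OF \<Phi>_measurable[OF fb]]) auto
  also have "\<dots> = 1 / card ?B"
    unfolding \<Phi>_distr[OF fb] using \<sigma>(1) fin by (simp only: measure_uniform_count_measure empty_subsetI insert_subset) simp
  also have "real (card ?B) = catalan (n - 1)"
    using bij_betw_same_card[OF bij] card_irred_lists[of a "n - 1"] assms(1) by simp
  finally show ?thesis .
qed

end

lemma irred_blocks_nth:
  "irred_blocks a bs \<Longrightarrow> i < length bs \<Longrightarrow>
     bs ! i \<noteq> [] \<and> bs ! i \<in> irred_lists (a + length (concat (take i bs))) (length (bs ! i))"
proof (induction bs arbitrary: a i)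
  case (Cons b bs)
  then show ?case
  proof (cases i)
    case (Suc j)
    then show ?thesis using Cons.IH[of "a + length b" j] Cons.prems by (simp add: add.assoc)
  qed auto
qed simp

context random_blocks
begin

text \<open>A block of size l contributes C_(l-1) / (2 * 4^(l-1)) for its size and 1 / C_(l-1) for
  its content, together 2 * 4^(-l). The resulting 2^j meets 2^(-j-1) from Y = j + 1.\<close>

lemma prob_pieces:
  assumes bs: "irred_blocks 0 bs"
  shows "prob {\<omega> \<in> space M. pieces X Y \<Phi> \<omega> = bs} = (1/4) ^ length (concat bs) / 2"
proof -
  define j where "j = length bs"
  define off where "off i = length (concat (take i bs))" for i
  define l where "l i = length (bs ! i)" for i
  define K where "K i = {Suc (off i)..off i + l i}" for i
  have irr: "bs ! i \<in> irred_lists (off i) (l i)" "0 < l i" if "i < j" for i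
    using irred_blocks_nth[OF bs, of i] that by (auto simp: j_def off_def l_def)
  have K_fb: "K i \<in> finite_blocks" if "i < j" for i
    unfolding K_def by (rule atLeastAtMost_in_finite_blocks) (use irr that in auto)
  \<comment> \<open>Distinct positions use distinct blocks, hence distinct members of the
    independent family.\<close>
  have K_inj: "i = i'" if "i < j" "i' < j" "K i = K i'" for i i'
  proof -
    have lt: "off i < off i'" if "i < i'" "i' < j" for i i'
    proof -
      have "length (concat (take (Suc i) bs)) \<le> length (concat (take i' bs))"
        using that by (metis Suc_leI concat_append length_append le_add1 min_def take_append take_take append_take_drop_id)
      then have "off i + l i \<le> off i'"
        using that by (simp add: take_Suc_conv_app_nth off_def l_def j_def)
      then show ?thesis using irr(2)[of i] that by linarith
    qed
    have "off i = off i'" using that(3) irr(2)[OF that(1)] irr(2)[OF that(2)] unfolding K_def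
      by (metis Icc_eq_Icc Suc_inject Suc_leI le_add1 less_add_same_cancel1)
    then show ?thesis using lt that by (metis less_irrefl linorder_neqE_nat)
  qed
  \<comment> \<open>One event per member of the family. A block does not name its position i, so the
    event quantifies over all matching positions; \<open>K_inj\<close> reduces this to one.\<close>
  define A where "A idx = (case idx of
      X_index n \<Rightarrow> {\<omega> \<in> space M. X n \<omega> = l (n - 1)}
    | Y_index \<Rightarrow> {\<omega> \<in> space M. Y \<omega> = j + 1}
    | Perm_index I \<Rightarrow> {\<omega> \<in> space M. \<forall>i<j. K i = I \<longrightarrow> listing (off i) (l i) (\<Phi> I \<omega>) = bs ! i})" for idx
  define JX JP where "JX = X_index ` Suc ` {..<j}" and "JP = Perm_index ` K ` {..<j}"
  define J where "J = JX \<union> {Y_index} \<union> JP"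
  have A_perm: "A (Perm_index (K i)) = {\<omega> \<in> space M. listing (off i) (l i) (\<Phi> (K i) \<omega>) = bs ! i}" if "i < j" for i
    using K_inj that unfolding A_def by (auto simp del: upt_Suc)
  have A_X: "A (X_index (Suc i)) = {\<omega> \<in> space M. X (Suc i) \<omega> = l i}" for i by (simp add: A_def)
  have A_Y: "A Y_index = {\<omega> \<in> space M. Y \<omega> = j + 1}" by (simp add: A_def)
  \<comment> \<open>Only almost surely, since the case Y = 0 must be removed.\<close>
  have "AE \<omega> in M. pieces X Y \<Phi> \<omega> = bs \<longleftrightarrow> \<omega> \<in> (\<Inter>idx\<in>J. A idx)"
    using AE_Y_positive AE_space
  proof eventually_elim
    case (elim \<omega>)
    have "\<omega> \<in> (\<Inter>idx\<in>J. A idx) \<longleftrightarrow> \<omega> \<in> A Y_index \<and> (\<forall>i<j. \<omega> \<in> A (X_index (Suc i))) \<and>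
        (\<forall>i<j. \<omega> \<in> A (Perm_index (K i)))"
      by (auto simp: J_def JX_def JP_def)
    also have "\<dots> \<longleftrightarrow> Y \<omega> = j + 1 \<and> (\<forall>i<j. X (Suc i) \<omega> = l i) \<and>
        (\<forall>i<j. listing (off i) (l i) (\<Phi> (K i) \<omega>) = bs ! i)"
      using elim(2) A_perm by (simp add: A_X A_Y del: upt_Suc)
    also have "\<dots> \<longleftrightarrow> pieces X Y \<Phi> \<omega> = bs"
      unfolding pieces_eq_iff j_def[symmetric] l_def[symmetric] off_def[symmetric] K_def[symmetric]
      using elim(1) by (auto simp del: upt_Suc)
    finally show ?case by simp
  qed
  moreover have ev: "A idx \<in> events" if "idx \<in> J" for idx
  proof -
    have "{\<omega> \<in> space M. listing (off i) (l i) (\<Phi> (K i) \<omega>) = bs ! i} \<in> events" for i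
      unfolding K_def by measurable
    then have "A (Perm_index (K i)) \<in> events" if "i < j" for i
      using A_perm[OF that] by (simp only:)
    moreover have "A (X_index (Suc i)) \<in> events" for i unfolding A_def by simp
    moreover have "A Y_index \<in> events" unfolding A_def by simp
    ultimately show ?thesis using that by (auto simp: J_def JX_def JP_def)
  qed
  have finJ: "finite J" "J \<noteq> {}" by (auto simp: J_def JX_def JP_def)
  have pm: "{\<omega> \<in> space M. pieces X Y \<Phi> \<omega> = bs} \<in> events"
    using pieces_measurable by measurable
  ultimately have "prob {\<omega> \<in> space M. pieces X Y \<Phi> \<omega> = bs} = prob (\<Inter>idx\<in>J. A idx)"
    using finJ ev by (intro finite_measure_eq_AE) auto
  also have "\<dots> = (\<Prod>idx\<in>J. prob (A idx))"
  proof (rule indep_setsD[OF indep[unfolded mutually_independent_def]])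
    show "J \<subseteq> X_index ` {1..} \<union> {Y_index} \<union> Perm_index ` finite_blocks"
      using K_fb by (auto simp: J_def JX_def JP_def)
    show "\<forall>idx\<in>J. A idx \<in> (case idx of
          X_index n \<Rightarrow> {X n -` A \<inter> space M |A. A \<in> sets (count_space UNIV)}
        | Y_index \<Rightarrow> {Y -` A \<inter> space M |A. A \<in> sets (count_space UNIV)}
        | Perm_index I \<Rightarrow>
            {\<Phi> I -` A \<inter> space M |A. A \<in> sets (count_space (birr_avoiders I [3, 2, 1]))})"
    proof
      fix idx assume "idx \<in> J"
      then consider (1) i where "idx = X_index (Suc i)" | (2) "idx = Y_index" | (3) i where "idx = Perm_index (K i)" "i < j"
        by (auto simp: J_def JX_def JP_def)
      then show "A idx \<in> (case idx of
          X_index n \<Rightarrow> {X n -` A \<inter> space M |A. A \<in> sets (count_space UNIV)}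
        | Y_index \<Rightarrow> {Y -` A \<inter> space M |A. A \<in> sets (count_space UNIV)}
        | Perm_index I \<Rightarrow>
            {\<Phi> I -` A \<inter> space M |A. A \<in> sets (count_space (birr_avoiders I [3, 2, 1]))})"
      proof cases
        case (1 i)
        then show ?thesis by (auto simp: A_def intro!: exI[of _ "{l i}"])
      next
        case 2
        then show ?thesis by (auto simp: A_def intro!: exI[of _ "{j + 1}"])
      next
        case (3 i)
        define S where "S = {\<sigma> \<in> birr_avoiders (K i) [3, 2, 1]. listing (off i) (l i) \<sigma> = bs ! i}"
        have "A (Perm_index (K i)) = \<Phi> (K i) -` S \<inter> space M"
          unfolding A_perm[OF 3(2)] S_def
          using measurable_space[OF \<Phi>_measurable[OF K_fb[OF 3(2)]]] by (auto simp del: upt_Suc)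
        moreover have "S \<in> sets (count_space (birr_avoiders (K i) [3, 2, 1]))" by (auto simp: S_def)
        ultimately show ?thesis unfolding 3(1) family_index.case by (intro CollectI exI[of _ S] conjI)
      qed
    qed
  qed (rule finJ)+
  also have "\<dots> = (\<Prod>idx\<in>JX. prob (A idx)) * prob (A Y_index) * (\<Prod>idx\<in>JP. prob (A idx))"
  proof -
    have fin: "finite JX" "finite JP" by (simp_all add: JX_def JP_def)
    have disj: "JX \<inter> {Y_index} = {}" "(JX \<union> {Y_index}) \<inter> JP = {}" by (auto simp: JX_def JP_def)
    show ?thesis
      unfolding J_def using fin
      by (simp only: prod.union_disjoint[OF _ _ disj(2)] prod.union_disjoint[OF _ _ disj(1)] finite_Un finite.intros) simp
  qed
  also have "(\<Prod>idx\<in>JX. prob (A idx)) = (\<Prod>i<j. prob (A (X_index (Suc i))))"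
    unfolding JX_def by (simp add: prod.reindex inj_on_def)
  also have "\<dots> = (\<Prod>i<j. catalan (l i - 1) / (2 * 4 ^ (l i - 1)))"
  proof (rule prod.cong[OF refl])
    fix i assume "i \<in> {..<j}"
    then show "prob (A (X_index (Suc i))) = catalan (l i - 1) / (2 * 4 ^ (l i - 1))"
      using X_prob[of "Suc i" "l i - 1"] irr(2)[of i] by (simp add: A_def)
  qed
  also have "prob (A Y_index) = (1/2) ^ (j + 1)"
    unfolding A_def using Y_prob[of "j + 1"] by simp
  also have "(\<Prod>idx\<in>JP. prob (A idx)) = (\<Prod>i<j. prob (A (Perm_index (K i))))"
    unfolding JP_def using K_inj by (subst prod.reindex, simp add: inj_on_def)+ (simp add: inj_on_def)
  also have "\<dots> = (\<Prod>i<j. 1 / catalan (l i - 1))"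
  proof (rule prod.cong[OF refl])
    fix i assume "i \<in> {..<j}"
    then show "prob (A (Perm_index (K i))) = 1 / catalan (l i - 1)"
      using prob_listing_\<Phi>[of "l i" "bs ! i" "off i"] irr[of i] A_perm[of i] by (simp add: K_def del: upt_Suc)
  qed
  also have "(\<Prod>i<j. catalan (l i - 1) / (2 * 4 ^ (l i - 1))) * (1/2) ^ (j + 1) * (\<Prod>i<j. 1 / catalan (l i - 1))
      = (1/2) ^ (j + 1) * (\<Prod>i<j. 2 * (1/4) ^ l i)"
  proof -
    have "catalan (l i - 1) / (2 * 4 ^ (l i - 1)) * (1 / catalan (l i - 1)) = 2 * (1/4) ^ l i" if "i < j" for i
      using irr(2)[OF that] catalan_pos[of "l i - 1"] by (cases "l i") (auto simp: power_one_over)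
    then have "(\<Prod>i<j. catalan (l i - 1) / (2 * 4 ^ (l i - 1))) * (\<Prod>i<j. 1 / catalan (l i - 1)) = (\<Prod>i<j. 2 * (1/4) ^ l i)"
      unfolding prod.distrib[symmetric] by (intro prod.cong) auto
    moreover have "a * b * c = b * (a * c)" for a b c :: real by (simp only: mult_ac)
    ultimately show ?thesis by (simp only:)
  qed
  also have "(\<Prod>i<j. 2 * (1/4 :: real) ^ l i) = 2 ^ j * (1/4) ^ (\<Sum>i<j. l i)"
    by (simp add: prod.distrib power_sum)
  also have "(\<Sum>i<j. l i) = length (concat bs)"
    by (simp add: length_concat sum_list_sum_nth l_def j_def lessThan_atLeast0)
  finally show ?thesis by (simp add: power_one_over)
qed

end

section \<open>Coupling with the weak limit\<close>

text \<open>The nonnegative differences q - p have total 0, so each of them vanishes.\<close>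

lemma countable_prob_squeeze:
  fixes p q :: "'i \<Rightarrow> ennreal"
  assumes "\<And>i. i \<in> I \<Longrightarrow> p i \<le> q i" "(\<integral>\<^sup>+i. p i \<partial>count_space I) = 1" "(\<integral>\<^sup>+i. q i \<partial>count_space I) \<le> 1"
    and "i \<in> I"
  shows "q i = p i"
proof -
  have "(\<integral>\<^sup>+i. q i - p i \<partial>count_space I) = (\<integral>\<^sup>+i. q i \<partial>count_space I) - (\<integral>\<^sup>+i. p i \<partial>count_space I)"
    using assms by (intro nn_integral_diff) (auto simp: AE_count_space)
  also have "\<dots> = 0"
    using assms(2,3) le_less_trans[OF assms(3) ennreal_one_less_top] by (simp add: diff_eq_0_iff_ennreal)
  finally have "q i - p i = 0"
    using assms(4) by (subst (asm) nn_integral_0_iff_AE) (auto simp: AE_count_space)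
  then show ?thesis using assms(1)[OF assms(4)] by (metis antisym diff_eq_0_iff_ennreal ennreal_minus_eq_0)
qed

locale coupling = random_blocks M X Y \<Phi> + limit: avoider_limit \<mu> r
  for M :: "'a measure" and X Y \<Phi> \<mu> r
begin

definition "blocks \<equiv> pieces X Y \<Phi>"

lemma blocks_measurable [measurable]: "blocks \<in> measurable M (count_space UNIV)"
  unfolding blocks_def by (rule pieces_measurable)

lemma last_split_sets_limit [measurable]: "last_split w \<in> sets \<mu>"
  by (rule limit.last_split_event)

lemma emeasure_blocks:
  assumes "irred_blocks 0 bs"
  shows "emeasure M {\<omega> \<in> space M. blocks \<omega> = bs} = ennreal ((1/4) ^ length (concat bs) / 2)"
  using prob_pieces[OF assms] by (simp add: emeasure_eq_measure blocks_def)

text \<open>The weights are the probabilities of the values of \<open>blocks\<close>, which is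
  almost surely an irreducible block list.\<close>

lemma nn_integral_irred_blocks:
  "(\<integral>\<^sup>+bs. ennreal ((1/4) ^ length (concat bs) / 2) \<partial>count_space {bs. irred_blocks 0 bs}) = 1"
proof -
  have "(\<integral>\<^sup>+bs. ennreal ((1/4) ^ length (concat bs) / 2) \<partial>count_space {bs. irred_blocks 0 bs}) =
      (\<integral>\<^sup>+bs. emeasure M {\<omega> \<in> space M. blocks \<omega> = bs} \<partial>count_space {bs. irred_blocks 0 bs})"
    by (intro nn_integral_cong) (simp add: emeasure_blocks)
  also have "\<dots> = emeasure M (\<Union>bs\<in>{bs. irred_blocks 0 bs}. {\<omega> \<in> space M. blocks \<omega> = bs})"
    by (rule emeasure_UN_countable[symmetric]) (auto simp: disjoint_family_on_def)
  also have "(\<Union>bs\<in>{bs. irred_blocks 0 bs}. {\<omega> \<in> space M. blocks \<omega> = bs}) = {\<omega> \<in> space M. irred_blocks 0 (blocks \<omega>)}"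
    by auto
  also have "emeasure M \<dots> = 1"
    using AE_irred_blocks by (intro emeasure_eq_1_AE) (auto simp: blocks_def[symmetric])
  finally show ?thesis .
qed

lemma emeasure_UN_last_split:
  "emeasure \<mu> (\<Union>bs\<in>{bs. irred_blocks 0 bs}. last_split (concat bs)) =
     (\<integral>\<^sup>+bs. emeasure \<mu> (last_split (concat bs)) \<partial>count_space {bs. irred_blocks 0 bs})"
  by (rule emeasure_UN_countable) (use last_split_unique in \<open>auto simp: disjoint_family_on_def\<close>)

text \<open>The squeeze takes p from the random listing, with full mass, and q from \<mu>, whose
  disjoint events have mass at most 1.\<close>

lemma emeasure_last_split:
  assumes "irred_blocks 0 bs"
  shows "emeasure \<mu> (last_split (concat bs)) = ennreal ((1/4) ^ length (concat bs) / 2)"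
proof (rule countable_prob_squeeze[where I = "{bs. irred_blocks 0 bs}"])
  fix bs assume "bs \<in> {bs. irred_blocks 0 bs}"
  then show "ennreal ((1/4) ^ length (concat bs) / 2) \<le> emeasure \<mu> (last_split (concat bs))"
    using limit.prob_last_split_ge[OF irred_blocks_concat, of bs]
    by (simp add: limit.emeasure_eq_measure ennreal_leI)
next
  show "(\<integral>\<^sup>+bs. emeasure \<mu> (last_split (concat bs)) \<partial>count_space {bs. irred_blocks 0 bs}) \<le> 1"
    unfolding emeasure_UN_last_split[symmetric] by (rule limit.emeasure_le_1)
qed (use assms nn_integral_irred_blocks in auto)

text \<open>The events already carry mass 1, so infinitely many splits have probability
  zero.\<close>

lemma AE_last_split: "AE \<sigma> in \<mu>. \<exists>bs. irred_blocks 0 bs \<and> \<sigma> \<in> last_split (concat bs)"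
proof -
  have "emeasure \<mu> (\<Union>bs\<in>{bs. irred_blocks 0 bs}. last_split (concat bs)) =
      (\<integral>\<^sup>+bs. ennreal ((1/4) ^ length (concat bs) / 2) \<partial>count_space {bs. irred_blocks 0 bs})"
    unfolding emeasure_UN_last_split by (intro nn_integral_cong) (simp add: emeasure_last_split)
  then have "limit.prob (\<Union>bs\<in>{bs. irred_blocks 0 bs}. last_split (concat bs)) = 1"
    using nn_integral_irred_blocks by (simp add: limit.emeasure_eq_measure)
  then have "AE \<sigma> in \<mu>. \<sigma> \<in> (\<Union>bs\<in>{bs. irred_blocks 0 bs}. last_split (concat bs))"
    by (subst (asm) limit.prob_eq_1) auto
  then show ?thesis by (rule AE_mp) auto
qed

section \<open>The coupling measure and its marginals\<close>

text \<open>
  The weight is the reciprocal of the probability of the decomposition, which is the same under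
  \<open>M\<close> and under \<open>\<mu>\<close>; hence both marginals are preserved.
\<close>

definition coupling_density :: "'a \<times> (nat \<Rightarrow> enat) \<Rightarrow> ennreal" where
  "coupling_density p = (if irred_blocks 0 (blocks (fst p)) \<and> snd p \<in> last_split (concat (blocks (fst p)))
     then ennreal (2 * 4 ^ length (concat (blocks (fst p)))) else 0)"

text \<open>The two laws are glued along their common block list; given that list, the coordinates
  are independent.\<close>

definition joint :: "('a \<times> (nat \<Rightarrow> enat)) measure" where
  "joint = density (M \<Otimes>\<^sub>M \<mu>) coupling_density"

lemma blocks_fst_measurable: "(\<lambda>p. blocks (fst p)) \<in> measurable (M \<Otimes>\<^sub>M \<mu>) (count_space UNIV)"
  by measurable

lemma coupling_density_measurable [measurable]: "coupling_density \<in> borel_measurable (M \<Otimes>\<^sub>M \<mu>)"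
proof -
  have "(\<lambda>p. if irred_blocks 0 bs \<and> snd p \<in> last_split (concat bs)
     then ennreal (2 * 4 ^ length (concat bs)) else 0) \<in> borel_measurable (M \<Otimes>\<^sub>M \<mu>)" for bs
    by measurable
  from measurable_compose_countable[OF this blocks_fst_measurable]
  show ?thesis unfolding coupling_density_def[abs_def] .
qed

lemma sets_joint [measurable_cong]: "sets joint = sets (M \<Otimes>\<^sub>M \<mu>)"
  by (simp add: joint_def)

lemma space_joint: "space joint = space M \<times> seqs"
  by (simp add: joint_def space_pair_measure)

lemma weight_cancel: "ennreal (2 * 4 ^ n) * ennreal ((1/4) ^ n / 2) = 1"
  by (simp add: ennreal_mult[symmetric] power_one_over)

lemma distr_joint_fst: "distr joint M fst = M"
proof (rule measure_eqI)
  fix A assume "A \<in> sets (distr joint M fst)"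
  then have A [measurable]: "A \<in> sets M" by simp
  have "emeasure (distr joint M fst) A = emeasure joint (fst -` A \<inter> space (M \<Otimes>\<^sub>M \<mu>))"
    by (subst emeasure_distr) (simp_all add: joint_def)
  also have "\<dots> = (\<integral>\<^sup>+p. coupling_density p * indicator A (fst p) \<partial>(M \<Otimes>\<^sub>M \<mu>))"
    unfolding joint_def by (subst emeasure_density) (auto intro!: nn_integral_cong simp: indicator_def)
  also have "\<dots> = (\<integral>\<^sup>+\<omega>. \<integral>\<^sup>+\<sigma>. coupling_density (\<omega>, \<sigma>) * indicator A \<omega> \<partial>\<mu> \<partial>M)"
    by (subst limit.nn_integral_fst[symmetric]) simp_all
  also have "\<dots> = (\<integral>\<^sup>+\<omega>. indicator A \<omega> \<partial>M)"
  proof (rule nn_integral_cong_AE)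
    show "AE \<omega> in M. (\<integral>\<^sup>+\<sigma>. coupling_density (\<omega>, \<sigma>) * indicator A \<omega> \<partial>\<mu>) = indicator A \<omega>"
      using AE_irred_blocks unfolding blocks_def[symmetric]
    proof eventually_elim
      case (elim \<omega>)
      have "(\<integral>\<^sup>+\<sigma>. coupling_density (\<omega>, \<sigma>) * indicator A \<omega> \<partial>\<mu>) =
          (\<integral>\<^sup>+\<sigma>. (ennreal (2 * 4 ^ length (concat (blocks \<omega>))) * indicator A \<omega>) *
             indicator (last_split (concat (blocks \<omega>))) \<sigma> \<partial>\<mu>)"
        using elim by (intro nn_integral_cong) (simp add: coupling_density_def indicator_def)
      also have "\<dots> = ennreal (2 * 4 ^ length (concat (blocks \<omega>))) * indicator A \<omega> *
          emeasure \<mu> (last_split (concat (blocks \<omega>)))"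
        by (subst nn_integral_cmult_indicator) simp_all
      also have "\<dots> = indicator A \<omega>"
        unfolding emeasure_last_split[OF elim] using weight_cancel[of "length (concat (blocks \<omega>))"]
        by (metis mult.assoc mult.commute mult_1)
      finally show ?case .
    qed
  qed
  also have "\<dots> = emeasure M A" by simp
  finally show "emeasure (distr joint M fst) A = emeasure M A" .
qed simp

lemma distr_joint_snd: "distr joint \<mu> snd = \<mu>"
proof (rule measure_eqI)
  interpret P: pair_sigma_finite M \<mu> ..
  fix B assume "B \<in> sets (distr joint \<mu> snd)"
  then have B [measurable]: "B \<in> sets \<mu>" by simp
  have "emeasure (distr joint \<mu> snd) B = emeasure joint (snd -` B \<inter> space (M \<Otimes>\<^sub>M \<mu>))"
    by (subst emeasure_distr) (simp_all add: joint_def)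
  also have "\<dots> = (\<integral>\<^sup>+p. coupling_density p * indicator B (snd p) \<partial>(M \<Otimes>\<^sub>M \<mu>))"
    unfolding joint_def by (subst emeasure_density) (auto intro!: nn_integral_cong simp: indicator_def)
  also have "\<dots> = (\<integral>\<^sup>+\<sigma>. \<integral>\<^sup>+\<omega>. coupling_density (\<omega>, \<sigma>) * indicator B \<sigma> \<partial>M \<partial>\<mu>)"
    by (subst P.nn_integral_snd[symmetric]) simp_all
  also have "\<dots> = (\<integral>\<^sup>+\<sigma>. indicator B \<sigma> \<partial>\<mu>)"
  proof (rule nn_integral_cong_AE)
    show "AE \<sigma> in \<mu>. (\<integral>\<^sup>+\<omega>. coupling_density (\<omega>, \<sigma>) * indicator B \<sigma> \<partial>M) = indicator B \<sigma>"
      using AE_last_split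
    proof eventually_elim
      case (elim \<sigma>)
      \<comment> \<open>The block list of \<sigma> is unique, so as a function of \<omega> the
        density is a multiple of the indicator of \<open>blocks \<omega> = bs\<close>.\<close>
      then obtain bs where bs: "irred_blocks 0 bs" "\<sigma> \<in> last_split (concat bs)" by blast
      have "(\<integral>\<^sup>+\<omega>. coupling_density (\<omega>, \<sigma>) * indicator B \<sigma> \<partial>M) =
          (\<integral>\<^sup>+\<omega>. (ennreal (2 * 4 ^ length (concat bs)) * indicator B \<sigma>) *
             indicator {\<omega> \<in> space M. blocks \<omega> = bs} \<omega> \<partial>M)"
        using last_split_unique bs
        by (intro nn_integral_cong) (auto simp: coupling_density_def indicator_def)
      also have "\<dots> = ennreal (2 * 4 ^ length (concat bs)) * indicator B \<sigma> *
          emeasure M {\<omega> \<in> space M. blocks \<omega> = bs}"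
        by (subst nn_integral_cmult_indicator) simp_all
      also have "\<dots> = indicator B \<sigma>"
        unfolding emeasure_blocks[OF bs(1)] using weight_cancel[of "length (concat bs)"]
        by (metis mult.assoc mult.commute mult_1)
      finally show ?case .
    qed
  qed
  also have "\<dots> = emeasure \<mu> B" by simp
  finally show "emeasure (distr joint \<mu> snd) B = emeasure \<mu> B" .
qed simp

lemma AE_joint: "AE p in joint. irred_blocks 0 (blocks (fst p)) \<and> snd p \<in> last_split (concat (blocks (fst p)))"
  unfolding joint_def by (subst AE_density) (auto simp: coupling_density_def)

lemma AE_joint_snd:
  assumes "AE \<sigma> in \<mu>. P \<sigma>"
  shows "AE p in joint. P (snd p)"
proof (rule AE_distrD[of snd joint \<mu>])
  show "AE \<sigma> in distr joint \<mu> snd. P \<sigma>" unfolding distr_joint_snd by (rule assms)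
qed simp

end

section \<open>Sequences as streams, and irreducibility of the tail\<close>

lemma stream_eq_snthI: "(\<And>n. s !! n = t !! n) \<Longrightarrow> s = t"
  by (metis smap_alt stream.map_ident)

definition to_stream :: "(nat \<Rightarrow> enat) \<Rightarrow> enat stream" where
  "to_stream \<sigma> = smap \<sigma> (fromN 1)"

lemma to_stream_snth [simp]: "to_stream \<sigma> !! n = \<sigma> (Suc n)"
  by (simp add: to_stream_def)

lemma seq_of_to_stream: "\<sigma> \<in> seqs \<Longrightarrow> seq_of_stream (to_stream \<sigma>) = \<sigma>"
  by (rule ext) (auto simp: seq_of_stream_def seqs_def PiE_def extensional_def)

lemma prefix_shift_tail:
  assumes "\<sigma> \<in> cylinder w"
  shows "map enat w @- sdrop (length w) (to_stream \<sigma>) = to_stream \<sigma>"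
proof -
  have "stake (length w) (to_stream \<sigma>) = map enat w"
    using assms by (intro nth_equalityI) (auto simp: cylinder_def)
  then show ?thesis by (metis stake_sdrop)
qed

text \<open>The target is countable; the value \<infinity> is handled as the complement of all
  finite values.\<close>

lemma coordinate_measurable:
  assumes "1 \<le> i"
  shows "(\<lambda>\<sigma>. \<sigma> i) \<in> measurable seqs_borel (count_space {1..})"
proof -
  have fin: "{\<sigma> \<in> seqs. \<sigma> i = enat a} \<in> sets seqs_borel" for a
    by (rule clopen_in_sets[OF clopen_coordinate[OF assms]])
  have "{\<sigma> \<in> seqs. \<sigma> i = e} \<in> sets seqs_borel" for e
  proof (cases e)
    case infinity
    have "{\<sigma> \<in> seqs. \<sigma> i = \<infinity>} = space seqs_borel - (\<Union>a. {\<sigma> \<in> seqs. \<sigma> i = enat a})" by auto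
    also have "\<dots> \<in> sets seqs_borel" using fin by (intro sets.compl_sets sets.countable_UN) auto
    finally show ?thesis using infinity by simp
  qed (use fin in simp)
  moreover have "(\<lambda>\<sigma>. \<sigma> i) -` {e} \<inter> space seqs_borel = {\<sigma> \<in> seqs. \<sigma> i = e}" for e by auto
  moreover have "\<sigma> i \<in> {1..}" if "\<sigma> \<in> seqs" for \<sigma> using that assms by (auto simp: seqs_def PiE_def Pi_def)
  ultimately show ?thesis
    by (subst measurable_count_space_eq2_countable) auto
qed

text \<open>Injectivity is required on finite values only, so padding a finite listing with
  \<infinity> stays in the space.\<close>

lemma seq_of_finite_listing:
  assumes "distinct w" "0 \<notin> set w"
  shows "seq_of_stream (map enat w @- sconst \<infinity>) \<in> seqs"
proof -
  let ?s = "map enat w @- sconst \<infinity>"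
  have v: "?s !! n = (if n < length w then enat (w ! n) else \<infinity>)" for n
    by (auto simp: shift_snth)
  have pos: "1 \<le> ?s !! n" for n
  proof (cases "n < length w")
    case True
    then have "w ! n \<noteq> 0" using assms(2) nth_mem by metis
    then show ?thesis using True unfolding v by (simp add: one_enat_def Suc_le_eq)
  qed (simp add: v)
  have "m = n" if "?s !! m \<noteq> \<infinity>" "?s !! m = ?s !! n" for m n
    using that assms(1) unfolding v by (auto split: if_splits simp: nth_eq_iff_index_eq)
  then have "inj_on (seq_of_stream ?s) {i \<in> {1..}. seq_of_stream ?s i \<noteq> \<infinity>}"
    by (intro inj_onI) (force simp: seq_of_stream_def)
  then show ?thesis using pos by (auto simp: seqs_def seq_of_stream_def)
qed

text \<open>The first m values fill {1..m}, so bijectivity passes to the tail. A cut of the tail,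
  joined with this prefix, would be a later split of \<sigma>.\<close>

lemma tail_irreducible:
  assumes S: "\<sigma> \<in> S_infinity" and split: "\<sigma> \<in> last_split w" and w: "w \<in> avoiding_lists 0 m"
    and avoid: "\<And>i j k a b c. 1 \<le> i \<Longrightarrow> i < j \<Longrightarrow> j < k \<Longrightarrow> c < b \<Longrightarrow> b < a \<Longrightarrow>
      \<not> (\<sigma> i = enat a \<and> \<sigma> j = enat b \<and> \<sigma> k = enat c)"
  shows "\<exists>\<rho>\<in>birr_avoiders {m + 1..} [3, 2, 1]. sdrop m (to_stream \<sigma>) = perm_listing (m + 1) \<rho>"
proof -
  have len: "length w = m" using w by (rule avoiding_lists_length)
  have bij: "bij_betw \<sigma> {1..} (enat ` {1..})" using S by (simp add: S_infinity_def)
  have cylinder: "\<sigma> \<in> cylinder w" using split by (simp add: last_split_def)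
  have "{0<..0 + m} = {1..m}" by auto
  then have "set w = {1..m}" using w by (simp only: avoiding_lists_def mem_Collect_eq)
  then have init: "\<sigma> ` {1..m} = enat ` {1..m}" using cylinder_image[OF cylinder, of m] len by simp
  define \<rho> where "\<rho> i = (if m + 1 \<le> i then the_enat (\<sigma> i) else i)" for i
  have fin: "\<sigma> i = enat (the_enat (\<sigma> i))" if "1 \<le> i" for i
  proof -
    have "\<sigma> i \<in> enat ` {1..}" using bij_betwE[OF bij] that by simp
    then show ?thesis by (rule imageE) simp
  qed
  have \<rho>: "enat (\<rho> i) = \<sigma> i" if "m + 1 \<le> i" for i using fin[of i] that by (simp add: \<rho>_def)
  have diff: "{m + 1..} = {1..} - {1..m}" by auto
  have "\<sigma> ` {m + 1..} = enat ` {1..} - enat ` {1..m}"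
    unfolding diff using inj_on_image_set_diff[OF bij_betw_imp_inj_on[OF bij], of "{1..}" "{1..m}"] init
      bij_betw_imp_surj_on[OF bij] by auto
  also have "\<dots> = enat ` {m + 1..}" unfolding diff by (subst image_set_diff) (auto simp: inj_def)
  finally have "\<sigma> ` {m + 1..} = enat ` {m + 1..}" .
  moreover have "enat ` \<rho> ` {m + 1..} = \<sigma> ` {m + 1..}"
    unfolding image_image using \<rho> by (intro image_cong) auto
  moreover have "inj enat" by (simp add: inj_def)
  ultimately have img: "\<rho> ` {m + 1..} = {m + 1..}" by (metis inj_image_eq_iff)
  moreover have "inj_on \<rho> {m + 1..}"
  proof (rule inj_onI)
    fix i j assume ij: "i \<in> {m + 1..}" "j \<in> {m + 1..}" "\<rho> i = \<rho> j"
    then have "\<sigma> i = \<sigma> j" using \<rho> by (metis atLeast_iff)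
    then show "i = j" using ij bij_betw_imp_inj_on[OF bij] by (auto simp: inj_on_def)
  qed
  ultimately have perm: "\<rho> permutes {m + 1..}"
    by (intro bij_imp_permutes) (auto simp: bij_betw_def \<rho>_def)
  have "\<not> contains_pattern {m + 1..} \<rho> [3, 2, 1]"
    unfolding contains_321_iff
  proof (intro notI, elim bexE conjE)
    fix i j k assume "i \<in> {m + 1..}" "j \<in> {m + 1..}" "k \<in> {m + 1..}" "i < j" "j < k" "\<rho> k < \<rho> j" "\<rho> j < \<rho> i"
    then show False using avoid[of i j k "\<rho> k" "\<rho> j" "\<rho> i"] \<rho> by auto
  qed
  moreover have "block_irreducible {m + 1..} \<rho>"
  proof -
    have False if "0 < k" "\<rho> ` {Suc m..m + k} = {Suc m..m + k}" for k
    proof -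
      have "\<sigma> ` {Suc m..m + k} = enat ` \<rho> ` {Suc m..m + k}"
        unfolding image_image using \<rho> by (intro image_cong) auto
      then have "\<sigma> ` ({1..m} \<union> {Suc m..m + k}) = enat ` ({1..m} \<union> {Suc m..m + k})"
        unfolding image_Un using init that(2) by simp
      moreover have "{1..m} \<union> {Suc m..m + k} = {1..m + k}" by auto
      ultimately show False using split that(1) len by (auto simp: last_split_def)
    qed
    then show ?thesis using block_irreducible_infinite[of m \<rho>] by auto
  qed
  ultimately have "\<rho> \<in> birr_avoiders {m + 1..} [3, 2, 1]"
    using perm by (simp add: birr_avoiders_def avoiders_def)
  moreover have "sdrop m (to_stream \<sigma>) = perm_listing (m + 1) \<rho>"
    by (rule stream_eq_snthI) (simp add: perm_listing_def sdrop_snth \<rho> add.commute)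
  ultimately show ?thesis by blast
qed

section \<open>The tail Z and the law of the completed listing\<close>

context coupling
begin

text \<open>The constant \<infinity> off the agreement event keeps the completed listing in
  \<open>seqs\<close> at every point, not only almost everywhere.\<close>

definition tail :: "'a \<times> (nat \<Rightarrow> enat) \<Rightarrow> enat stream" where
  "tail p = (if snd p \<in> last_split (concat (blocks (fst p)))
     then sdrop (length (concat (blocks (fst p)))) (to_stream (snd p)) else sconst \<infinity>)"

definition listing_with_tail :: "'a \<times> (nat \<Rightarrow> enat) \<Rightarrow> nat \<Rightarrow> enat" where
  "listing_with_tail p = seq_of_stream (map enat (concat (blocks (fst p))) @- tail p)"

lemma blocks_fst_joint: "(\<lambda>p. blocks (fst p)) \<in> measurable joint (count_space UNIV)"
  using blocks_fst_measurable by (simp add: measurable_cong_sets[OF sets_joint refl])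

lemma snd_joint [measurable]: "snd \<in> measurable joint seqs_borel"
  using limit.sets_limit measurable_snd[of M \<mu>] by (simp add: measurable_cong_sets[OF sets_joint] cong: measurable_cong_sets)

lemma last_split_seqs_borel [measurable]: "last_split w \<in> sets seqs_borel"
  by (rule last_split_sets)

lemma tail_measurable: "tail \<in> measurable joint (stream_space (count_space {1..}))"
proof (rule measurable_stream_space2)
  fix n
  have "(\<lambda>p. if snd p \<in> last_split (concat bs) then snd p (Suc (length (concat bs) + n)) else \<infinity>)
      \<in> measurable joint (count_space {1..})" for bs
  proof (rule measurable_If)
    show "(\<lambda>p. snd p (Suc (length (concat bs) + n))) \<in> measurable joint (count_space {1..})"
      by (rule measurable_compose[OF snd_joint coordinate_measurable]) simp
    show "{p \<in> space joint. snd p \<in> last_split (concat bs)} \<in> sets joint" by measurable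
  qed simp
  moreover have "(\<lambda>p. tail p !! n) = (\<lambda>p. if snd p \<in> last_split (concat (blocks (fst p)))
      then snd p (Suc (length (concat (blocks (fst p))) + n)) else \<infinity>)"
    by (rule ext) (simp add: tail_def sdrop_snth)
  ultimately show "(\<lambda>p. tail p !! n) \<in> measurable joint (count_space {1..})"
    by (simp only:) (rule measurable_compose_countable[OF _ blocks_fst_joint])
qed

lemma listing_with_tail_eq:
  "snd p \<in> last_split (concat (blocks (fst p))) \<Longrightarrow> listing_with_tail p = snd p"
  unfolding listing_with_tail_def tail_def
  using prefix_shift_tail[of "snd p"] seq_of_to_stream[of "snd p"] by (simp add: last_split_def cylinder_def)

lemma listing_with_tail_measurable: "listing_with_tail \<in> measurable joint seqs_borel"
proof -
  \<comment> \<open>For these block lists the padded default lies in \<open>seqs\<close>. For each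
    fixed list the map is a choice between \<open>snd\<close> and a constant, and there are
    countably many lists.\<close>
  define I where "I = {bs. distinct (concat bs) \<and> (0 :: nat) \<notin> set (concat bs)}"
  have m: "(\<lambda>p. if snd p \<in> last_split (concat bs) then snd p
      else seq_of_stream (map enat (concat bs) @- sconst \<infinity>)) \<in> measurable joint seqs_borel" if "bs \<in> I" for bs
  proof (rule measurable_If)
    show "{p \<in> space joint. snd p \<in> last_split (concat bs)} \<in> sets joint" by measurable
    show "(\<lambda>p. seq_of_stream (map enat (concat bs) @- sconst \<infinity>)) \<in> measurable joint seqs_borel"
      using seq_of_finite_listing that by (intro measurable_const) (simp add: I_def)
  qed (rule snd_joint)
  have "(\<lambda>p. blocks (fst p)) \<in> measurable joint (count_space I)"
  proof (rule measurable_count_space_eq2_countable[THEN iffD2])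
    show "(\<lambda>p. blocks (fst p)) \<in> space joint \<rightarrow> I \<and> (\<forall>a\<in>I. (\<lambda>p. blocks (fst p)) -` {a} \<inter> space joint \<in> sets joint)"
      using pieces_positive_distinct measurable_sets[OF blocks_fst_joint]
      by (auto simp: I_def space_joint blocks_def)
  qed
  from measurable_compose_countable'[OF m this]
  show ?thesis
    by (rule measurable_cong[THEN iffD1, rotated])
      (auto simp: listing_with_tail_eq, simp add: listing_with_tail_def tail_def)
qed

lemma distr_listing_with_tail: "distr joint seqs_borel listing_with_tail = \<mu>"
proof -
  have "distr joint seqs_borel listing_with_tail = distr joint \<mu> snd"
  proof (rule distr_cong_AE)
    show "AE p in joint. listing_with_tail p = snd p"
      using AE_joint by eventually_elim (simp add: listing_with_tail_eq)
  qed (use limit.sets_limit listing_with_tail_measurable in simp_all)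
  then show ?thesis by (simp add: distr_joint_snd)
qed

lemma prob_space_joint: "prob_space joint"
  using prob_space_distrD[of fst joint M] distr_joint_fst prob_space_axioms by simp

lemma AE_tail_irreducible:
  assumes "limit.prob S_infinity = 1"
  shows "AE p in joint. \<exists>\<sigma>\<in>birr_avoiders {partial_sum X (Y (fst p) - 1) (fst p) + 1..} [3, 2, 1].
    tail p = perm_listing (partial_sum X (Y (fst p) - 1) (fst p) + 1) \<sigma>"
proof -
  \<comment> \<open>A non-measurable set has measure 0 by convention, so probability 1 entails
    measurability.\<close>
  have "S_infinity \<in> sets \<mu>"
    using assms measure_notin_sets by fastforce
  then have "AE \<sigma> in \<mu>. \<sigma> \<in> S_infinity" using assms limit.prob_eq_1 by blast
  from AE_joint_snd[OF this] AE_joint_snd[OF limit.AE_avoids] AE_joint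
  show ?thesis
  proof eventually_elim
    case (elim p)
    have len: "length (concat (blocks (fst p))) = partial_sum X (Y (fst p) - 1) (fst p)"
      using length_block_listing[of X Y \<Phi> "fst p"] by (simp add: block_listing_eq blocks_def)
    have "tail p = sdrop (partial_sum X (Y (fst p) - 1) (fst p)) (to_stream (snd p))"
      using elim(3) by (simp add: tail_def len)
    moreover have "concat (blocks (fst p)) \<in> avoiding_lists 0 (partial_sum X (Y (fst p) - 1) (fst p))"
      using irred_blocks_concat[of 0 "blocks (fst p)"] elim(3) by (simp add: len)
    ultimately show ?case
      using tail_irreducible[of "snd p" "concat (blocks (fst p))"] elim by metis
  qed
qed

end

section \<open>Transport to the required sample space\<close>

lemma AE_embed_measure:
  assumes "inj_on f (space M)" "AE x in M. P (f x)"
  shows "AE y in embed_measure M f. P y"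
proof -
  obtain S where S: "S \<in> null_sets M" "{x \<in> space M. \<not> P (f x)} \<subseteq> S"
    using assms(2) by (auto simp: eventually_ae_filter)
  have "f ` S \<in> null_sets (embed_measure M f)"
    using S(1) emeasure_embed_measure_image'[OF assms(1), of S]
    by (intro null_setsI in_sets_embed_measure) (auto simp: null_setsD1)
  then show ?thesis
    by (rule AE_I') (use S(2) in \<open>auto simp: space_embed_measure\<close>)
qed

theorem proposition2:
  fixes M :: "'a measure"
    and X :: "nat \<Rightarrow> 'a \<Rightarrow> nat"
    and Y :: "'a \<Rightarrow> nat"
    and \<Phi> :: "nat set \<Rightarrow> 'a \<Rightarrow> nat \<Rightarrow> nat"
    and r :: "nat \<Rightarrow> nat"
    and \<mu> :: "(nat \<Rightarrow> enat) measure"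
  assumes "prob_space M"
    and "\<And>n. 1 \<le> n \<Longrightarrow> X n \<in> measurable M (count_space UNIV)"
    and "\<And>n k. 1 \<le> n \<Longrightarrow> measure M {\<omega> \<in> space M. X n \<omega> = k + 1} = catalan k / (2 * 4 ^ k)"
    and "Y \<in> measurable M (count_space UNIV)"
    and "\<And>k. 1 \<le> k \<Longrightarrow> measure M {\<omega> \<in> space M. Y \<omega> = k} = (1/2) ^ k"
    and "\<And>I. I \<in> finite_blocks \<Longrightarrow>
           \<Phi> I \<in> measurable M (count_space (birr_avoiders I [3, 2, 1]))"
    and "\<And>I. I \<in> finite_blocks \<Longrightarrow>
           distr M (count_space (birr_avoiders I [3, 2, 1])) (\<Phi> I) =
             uniform_count_measure (birr_avoiders I [3, 2, 1])"
    and "mutually_independent M X Y \<Phi>"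
    and "strict_mono r" and "\<And>k. 1 \<le> r k"
    and "prob_space \<mu>" and "sets \<mu> = sets seqs_borel"
    and "weakly_converges seqs.mtopology (\<lambda>k. avoider_measure [3, 2, 1] (r k)) \<mu>"
  shows "\<exists>(N :: ('a \<times> enat stream) measure) p Z.
    extends_prob_space N p M \<and>
    Z \<in> measurable N (stream_space (count_space {1..})) \<and>
    (\<lambda>\<omega>. seq_of_stream (map enat (block_listing X Y \<Phi> (p \<omega>)) @- Z \<omega>))
      \<in> measurable N seqs_borel \<and>
    distr N seqs_borel
      (\<lambda>\<omega>. seq_of_stream (map enat (block_listing X Y \<Phi> (p \<omega>)) @- Z \<omega>)) = \<mu> \<and>
    (measure \<mu> S_infinity = 1 \<longrightarrow>
      (\<forall>y\<ge>1. \<forall>m.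
        let A = {\<omega> \<in> space N. Y (p \<omega>) = y \<and> partial_sum X (y - 1) (p \<omega>) = m}
        in measure N A > 0 \<longrightarrow>
          (AE \<omega> in uniform_measure N A.
             \<exists>\<sigma> \<in> birr_avoiders {m + 1..} [3, 2, 1]. Z \<omega> = perm_listing (m + 1) \<sigma>)))"
proof -
  interpret coupling M X Y \<Phi> \<mu> r
    using assms
    by (intro coupling.intro random_blocks.intro random_blocks_axioms.intro avoider_limit.intro
        avoider_limit_axioms.intro)
  \<comment> \<open>The coupling lives on pairs with a sequence, the claim on pairs with a stream.
    Encoding is injective on \<open>seqs\<close>, whose members are extensional, so \<open>h\<close>
    inverts \<open>g\<close> there and the measure can be transported.\<close>
  define g where "g = map_prod (id :: 'a \<Rightarrow> 'a) to_stream"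
  define h where "h = map_prod (id :: 'a \<Rightarrow> 'a) seq_of_stream"
  define N where "N = embed_measure joint g"
  have hg: "h (g q) = q" if "q \<in> space joint" for q
    using that by (cases q) (simp add: g_def h_def space_joint seq_of_to_stream)
  have inj: "inj_on g (space joint)" by (rule inj_on_inverseI[of _ h]) (rule hg)
  have g: "g \<in> measurable joint N"
    unfolding N_def by (rule measurable_embed_measure2'[OF inj])
  have N_distr: "distr joint N g = N"
    unfolding N_def by (rule embed_measure_eq_distr'[OF inj, symmetric])
  have fst_g: "fst (g q) = fst q" for q by (cases q) (simp add: g_def)
  have fst_N: "fst \<in> measurable N M"
    unfolding N_def by (rule measurable_embed_measure1) (simp add: fst_g)
  have ext: "extends_prob_space N fst M"
    unfolding extends_prob_space_def
  proof (intro conjI fst_N)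
    show "prob_space N"
      using prob_space.prob_space_distr[OF prob_space_joint g] N_distr by simp
    have "distr N M fst = distr joint M (fst \<circ> g)"
      using distr_distr[OF fst_N g] N_distr by simp
    also have "fst \<circ> g = fst" by (auto simp: fst_g)
    finally show "distr N M fst = M" by (simp add: distr_joint_fst)
  qed
  define Z where "Z = tail \<circ> h"
  have Z: "Z \<in> measurable N (stream_space (count_space {1..}))"
    unfolding N_def
    by (rule measurable_embed_measure1, rule measurable_cong[THEN iffD2, OF _ tail_measurable])
      (simp add: Z_def hg)
  define F where "F \<omega> = seq_of_stream (map enat (block_listing X Y \<Phi> (fst \<omega>)) @- Z \<omega>)" for \<omega>
  have F_g: "F (g q) = listing_with_tail q" if "q \<in> space joint" for q
    using that by (simp add: F_def Z_def hg fst_g listing_with_tail_def block_listing_eq blocks_def)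
  have F: "F \<in> measurable N seqs_borel"
    unfolding N_def
    by (rule measurable_embed_measure1, rule measurable_cong[THEN iffD2, OF _ listing_with_tail_measurable])
      (simp add: F_g)
  have "distr N seqs_borel F = distr joint seqs_borel (F \<circ> g)"
    using distr_distr[OF F g] N_distr by simp
  also have "\<dots> = distr joint seqs_borel listing_with_tail"
    by (rule distr_cong) (simp_all add: F_g)
  finally have distr_F: "distr N seqs_borel F = \<mu>" by (simp add: distr_listing_with_tail)
  have cond: "AE \<omega> in uniform_measure N {\<omega> \<in> space N. Y (fst \<omega>) = y \<and> partial_sum X (y - 1) (fst \<omega>) = m}.
      \<exists>\<sigma>\<in>birr_avoiders {m + 1..} [3, 2, 1]. Z \<omega> = perm_listing (m + 1) \<sigma>"
    if "measure \<mu> S_infinity = 1" for y m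
  proof (rule AE_uniform_measureI)
    note fst_N [measurable]
    show "{\<omega> \<in> space N. Y (fst \<omega>) = y \<and> partial_sum X (y - 1) (fst \<omega>) = m} \<in> sets N" by measurable
    \<comment> \<open>Irreducibility is proved with the random values of Y and the partial sum;
      restricted to the conditioning event these become y and m.\<close>
    have "AE q in joint. \<exists>\<sigma>\<in>birr_avoiders {partial_sum X (Y (fst (g q)) - 1) (fst (g q)) + 1..} [3, 2, 1].
        Z (g q) = perm_listing (partial_sum X (Y (fst (g q)) - 1) (fst (g q)) + 1) \<sigma>"
      using AE_tail_irreducible[OF that] AE_space
      by eventually_elim (simp add: Z_def hg fst_g)
    from AE_embed_measure[OF inj this]
    show "AE \<omega> in N. \<omega> \<in> {\<omega> \<in> space N. Y (fst \<omega>) = y \<and> partial_sum X (y - 1) (fst \<omega>) = m} \<longrightarrow>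
        (\<exists>\<sigma>\<in>birr_avoiders {m + 1..} [3, 2, 1]. Z \<omega> = perm_listing (m + 1) \<sigma>)"
      unfolding N_def by (rule AE_mp) (auto intro!: AE_I2)
  qed
  show ?thesis
    using ext Z F distr_F cond unfolding F_def Let_def
    by (intro exI[of _ N] exI[of _ fst] exI[of _ Z]) blast
qed

end
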